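(* Let $r\ge1$ be an integer and let $f:[-1,1]\to\mathbb{R}$ be such that $f,f',\dots,f^{(r-1)}$ are absolutely continuous on $[-1,1]$ and the $r$-th derivative $f^{(r)}$ is of bounded variation on $[-1,1]$. Let $U_r=\int_{-1}^1|f^{(r+1)}(x)|\,dx$ (in the sense explained in the context) and $\mathbf{A}=0.825031$. Then for every integer $N\ge r+1$, $$\|f-f_N\|_\infty\le\begin{cases}\dfrac{2\mathbf{A}U_1}{\sqrt{N-\frac23}}, & r=1,\\[3mm] \dfrac{\mathbf{A}\,(N+\frac32)\,U_r}{\left(r-\frac12\right)\sqrt{N-r+\frac13}\;\prod_{j=1}^{r}\left(N-r+2j-\frac32\right)}, & r\ge3\text{ odd},\\[3mm] \dfrac{\mathbf{A}\,(N+\frac12)\,U_r}{\left(r-\frac12\right)\sqrt{N-r+\frac13}\;\prod_{j=1}^{r}\left(N-r+2j-\frac32\right)}, & r\text{ even}.\end{cases}$$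
   Context: $L_n$ denotes the Legendre polynomial of degree $n$ (normalized by $L_n(1)=1$), $a_n=\left(n+\frac12\right)\int_{-1}^1 f(x)L_n(x)\,dx$ are the Legendre coefficients of $f$, and $f_N(x)=\sum_{n=0}^N a_nL_n(x)$ is the partial sum of its Legendre expansion. $\|\cdot\|_\infty$ is the supremum norm on $[-1,1]$. Since $f^{(r-1)}$ is absolutely continuous, $f^{(r)}$ exists almost everywhere; "$f^{(r)}$ is of bounded variation" means that it coincides almost everywhere with a function of bounded variation on $[-1,1]$. The derivative $f^{(r+1)}$ is understood as the distributional derivative of $f^{(r)}$, a finite signed measure on $(-1,1)$, and $U_r=\int_{-1}^1|f^{(r+1)}(x)|\,dx$ denotes its total variation (for example, if $f^{(r)}$ has a jump of size $c$ at an interior point, that jump contributes $|c|$ to $U_r$). *)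

theory Defs
  imports "HOL-Analysis.Analysis"
begin

subsection \<open>Legendre expansions\<close>

text \<open>Legendre polynomials through Bonnet's recursion
  \<open>(n + 2) L\<^sub>n\<^sub>+\<^sub>2 = (2 n + 3) x L\<^sub>n\<^sub>+\<^sub>1 - (n + 1) L\<^sub>n\<close>.\<close>

fun legendre_poly :: "nat \<Rightarrow> real poly" where
  "legendre_poly 0 = 1"
| "legendre_poly (Suc 0) = [:0, 1:]"
| "legendre_poly (Suc (Suc n)) =
     smult (1 / (real n + 2))
       (smult (2 * real n + 3) ([:0, 1:] * legendre_poly (Suc n))
         - smult (real n + 1) (legendre_poly n))"

lemma poly_legendre_poly_1: "poly (legendre_poly n) 1 = 1"
  by (induction n rule: legendre_poly.induct) (simp_all add: field_simps)

lemma legendre_poly_degree_lead_coeff: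
  "degree (legendre_poly n) = n \<and> lead_coeff (legendre_poly n) \<noteq> 0"
proof (induction n rule: legendre_poly.induct)
  case (3 n)
  let ?p = "smult (2 * real n + 3) ([:0, 1:] * legendre_poly (Suc n))"
  let ?q = "smult (real n + 1) (legendre_poly n)"
  have nz: "legendre_poly (Suc n) \<noteq> 0"
    using 3 by (metis leading_coeff_0_iff)
  have p: "degree ?p = Suc (Suc n)"
    using 3 nz by (simp add: degree_mult_eq)
  have q: "degree ?q = n"
    using 3 by simp
  have "degree (?p + - ?q) = degree ?p"
    by (rule degree_add_eq_left) (simp only: degree_minus p q)
  then have d: "degree (legendre_poly (Suc (Suc n))) = Suc (Suc n)"
    using p by simp
  then have "legendre_poly (Suc (Suc n)) \<noteq> 0"
    by (metis degree_0 nat.distinct(1))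
  with d show ?case by (metis leading_coeff_0_iff)
qed simp_all

definition legendre_coeff :: "(real \<Rightarrow> real) \<Rightarrow> nat \<Rightarrow> real" where
  "legendre_coeff f n =
     (real n + 1/2) * integral {-1..1} (\<lambda>x. f x * poly (legendre_poly n) x)"

definition legendre_partial_sum :: "(real \<Rightarrow> real) \<Rightarrow> nat \<Rightarrow> real \<Rightarrow> real" where
  "legendre_partial_sum f N x = (\<Sum>n\<le>N. legendre_coeff f n * poly (legendre_poly n) x)"

definition sup_norm :: "(real \<Rightarrow> real) \<Rightarrow> real" where
  "sup_norm h = (SUP x\<in>{-1..1}. \<bar>h x\<bar>)"

subsection \<open>Absolute continuity and bounded variation\<close>

text \<open>A finite family of non-overlapping compact subintervals of \<open>S\<close> is a set \<open>d\<close> with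
  \<open>d division_of \<Union>d\<close> and \<open>\<Union>d \<subseteq> S\<close>; the members \<open>k\<close> of \<open>d\<close> have end points \<open>Inf k\<close> and
  \<open>Sup k\<close>.\<close>

definition abs_continuous_on :: "real set \<Rightarrow> (real \<Rightarrow> real) \<Rightarrow> bool" where
  "abs_continuous_on S f \<longleftrightarrow>
     (\<forall>\<epsilon>>0. \<exists>\<delta>>0. \<forall>d. d division_of \<Union>d \<and> \<Union>d \<subseteq> S \<and> (\<Sum>k\<in>d. Sup k - Inf k) < \<delta>
        \<longrightarrow> (\<Sum>k\<in>d. \<bar>f (Sup k) - f (Inf k)\<bar>) < \<epsilon>)"

definition bounded_variation_on :: "real set \<Rightarrow> (real \<Rightarrow> real) \<Rightarrow> bool" where
  "bounded_variation_on S f \<longleftrightarrow>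
     (\<exists>B. \<forall>d. d division_of \<Union>d \<and> \<Union>d \<subseteq> S \<longrightarrow> (\<Sum>k\<in>d. \<bar>f (Sup k) - f (Inf k)\<bar>) \<le> B)"

subsection \<open>Iterated derivatives on the interval\<close>

text \<open>Derivatives are taken within \<open>[-1,1]\<close>, hence one-sided at the end points. At points of
  \<open>[-1,1]\<close> where a derivative does not exist, and outside \<open>[-1,1]\<close>, the value is unspecified.\<close>

definition nth_deriv :: "nat \<Rightarrow> (real \<Rightarrow> real) \<Rightarrow> real \<Rightarrow> real" where
  "nth_deriv k f = ((\<lambda>g x. vector_derivative g (at x within {-1..1})) ^^ k) f"

subsection \<open>Distributional derivatives that are measures\<close>

definition test_function :: "(real \<Rightarrow> real) \<Rightarrow> bool" where
  "test_function \<phi> \<longleftrightarrow>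
     (\<forall>k. ((deriv ^^ k) \<phi>) differentiable_on UNIV) \<and>
     compact (closure {x. \<phi> x \<noteq> 0}) \<and> closure {x. \<phi> x \<noteq> 0} \<subseteq> {-1<..<1}"

text \<open>A finite signed measure on \<open>(-1,1)\<close> is represented as a difference \<open>P - Q\<close> of two finite
  Borel measures, which need not be mutually singular.\<close>

definition has_distributional_derivative ::
    "(real \<Rightarrow> real) \<Rightarrow> real measure \<times> real measure \<Rightarrow> bool" where
  "has_distributional_derivative g = (\<lambda>(P, Q).
     g absolutely_integrable_on {-1<..<1} \<and>
     finite_measure P \<and> sets P = sets (restrict_space borel {-1<..<1}) \<and>
     finite_measure Q \<and> sets Q = sets (restrict_space borel {-1<..<1}) \<and>
     (\<forall>\<phi>. test_function \<phi> \<longrightarrow>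
        integral {-1<..<1} (\<lambda>x. g x * deriv \<phi> x)
          = - (integral\<^sup>L P \<phi> - integral\<^sup>L Q \<phi>)))"

text \<open>Total variation of the signed measure \<open>\<nu> = P - Q\<close>: the supremum of
  \<open>\<Sum>\<^sub>i \<bar>\<nu>(E\<^sub>i)\<bar>\<close> over the finite measurable partitions of the whole space. It depends only on
  the signed measure, not on the choice of \<open>P\<close> and \<open>Q\<close>.\<close>

definition signed_total_variation :: "real measure \<times> real measure \<Rightarrow> real" where
  "signed_total_variation = (\<lambda>(P, Q).
     Sup {(\<Sum>E\<in>\<E>. \<bar>measure P E - measure Q E\<bar>) |\<E>.
            finite \<E> \<and> \<E> \<subseteq> sets P \<and> disjoint \<E> \<and> \<Union>\<E> = space P})"

text \<open>The integral over \<open>(-1,1)\<close> of \<open>\<bar>g'\<bar>\<close>, for a distributional derivative \<open>g'\<close> that is a finite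
  signed measure. Such a measure is unique, so the choice below does not matter.\<close>

definition deriv_total_variation :: "(real \<Rightarrow> real) \<Rightarrow> real" where
  "deriv_total_variation g =
     signed_total_variation (SOME \<nu>. has_distributional_derivative g \<nu>)"

definition const_A :: real where
  "const_A = 0.825031"

end

theory Submission
  imports Defs
begin

text \<open>Write \<open>a\<^sub>n\<close> for the Legendre coefficients of \<open>f\<close>. On \<open>[-1,1]\<close> the Legendre polynomials are
bounded by 1, so once the Legendre series is known to converge to \<open>f\<close> the error is at most
\<open>\<Sum>n>N. \<bar>a\<^sub>n\<bar>\<close>, and everything rests on a sharp bound for a single coefficient.

By Rodrigues' formula \<open>L\<^sub>n\<close> is the derivative of order \<open>r + 1\<close> of the polynomial
\<open>y = D\<^bsup>n-r-1\<^esup> (x\<^sup>2 - 1)\<^sup>n / (2\<^sup>n n!)\<close>, and \<open>y\<close> and its first \<open>r\<close> derivatives vanish at both end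
points. Integrating by parts \<open>r + 1\<close> times turns \<open>a\<^sub>n\<close> into \<open>\<plusminus>(n + 1/2) \<integral> y d\<mu>\<close>, where \<open>\<mu>\<close> is the
distributional derivative of the \<open>r\<close>-th derivative of \<open>f\<close>. Hence \<open>\<bar>a\<^sub>n\<bar> \<le> (n + 1/2) U max \<bar>y\<bar>\<close>.

The maximum of \<open>\<bar>y\<bar>\<close> comes from Sonin's device. The polynomial \<open>y\<close> solves a second order equation
with an eigenvalue \<open>\<nu>\<close>, and the function \<open>y\<^sup>2 + (1 - x\<^sup>2) y'\<^sup>2 / \<nu>\<close>, which dominates \<open>y\<^sup>2\<close>,
decreases as \<open>x\<close> moves away from 0. (For \<open>L\<^sub>n\<close> itself it increases, which gives \<open>\<bar>L\<^sub>n\<bar> \<le> 1\<close>.) So only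
the values at 0 matter; they are quotients of double factorials, and an elementary estimate of
these quotients yields, with \<open>m = n - r - 1\<close> (lemma \<open>rodrigues_bound\<close>),
\<open>max \<bar>y\<bar> \<le> A / (sqrt (m + 1/2) (m + 2) (m + 4) \<cdots> (m + 2 r + 2))\<close>.

These bounds can be summed because they are dominated by differences \<open>h m - h (m + 2)\<close> of an
explicit function \<open>h\<close> (lemma \<open>tail_bound_telescope\<close>). The even and the odd \<open>m\<close> each contribute one
value of \<open>h\<close>, the error is at most \<open>A U (h (N - r) + h (N - r + 1)) / (2 r - 1)\<close>, and each of the
two summands is at most half of the bound in the theorem.

Three analytic facts make this rigorous. First, the integrations by parts use the fundamental
theorem of calculus for absolutely continuous functions (lemma \<open>abs_continuous_on_has_integral\<close>).
Second, the last one involves a distributional derivative, which is only known on compactly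
supported test functions, whereas \<open>y\<close> is a polynomial that vanishes to finite order at \<open>\<plusminus>1\<close>; smooth
cutoffs bridge this gap (lemma \<open>distributional_derivative_poly\<close>). A distributional derivative
exists at all because a function of bounded variation is a difference of monotone functions,
whose right-continuous versions are distribution functions of measures (lemma
\<open>distributional_derivative_exists\<close>). Third, the series has the sum \<open>f\<close> because it converges
uniformly, its sum has the same coefficients as \<open>f\<close>, and a continuous function orthogonal to all
polynomials is zero (lemma \<open>legendre_series_sums\<close>).\<close>

section \<open>Rodrigues' formula and the iterated integrals of Legendre polynomials\<close>

text \<open>The polynomial \<open>D\<^sup>j (x\<^sup>2 - 1)\<^sup>n / (2\<^sup>n n!)\<close>. It is \<open>L\<^sub>n\<close> for \<open>j = n\<close> and the \<open>(n - j)\<close>-fold iterated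
integral of \<open>L\<^sub>n\<close> from the end point \<open>-1\<close> for \<open>j < n\<close>, so that one family covers all stages of the
integrations by parts.\<close>

definition rodrigues :: "nat \<Rightarrow> nat \<Rightarrow> real poly" where
  "rodrigues n j = smult (1 / (2 ^ n * fact n)) ((pderiv ^^ j) ([:-1, 0, 1:] ^ n))"

lemma pderiv_rodrigues: "pderiv (rodrigues n j) = rodrigues n (Suc j)"
  by (simp add: rodrigues_def pderiv_smult)

lemma rodrigues_factor_Suc:
  "1 / (2 ^ Suc n * fact (Suc n)) * (2 * (1 + real n)) = 1 / (2 ^ n * fact n)"
proof -
  have "(2 * (1 + real n)) * 1 / ((2 * (1 + real n)) * (2 ^ n * fact n)) = 1 / (2 ^ n * fact n)"
    by (rule mult_divide_mult_cancel_left) simp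
  moreover have "(2 ^ Suc n * fact (Suc n) :: real) = (2 * (1 + real n)) * (2 ^ n * fact n)"
    by simp
  ultimately show ?thesis by (metis mult.commute mult.right_neutral times_divide_eq_left)
qed

lemma rodrigues_0_0: "rodrigues 0 0 = 1"
  by (simp add: rodrigues_def)

lemma rodrigues_Suc_0: "smult (2 * (real n + 1)) (rodrigues (Suc n) 0) = [:-1, 0, 1:] * rodrigues n 0"
proof -
  have "2 * (real n + 1) * (1 / (2 ^ Suc n * fact (Suc n))) = 1 / (2 ^ n * fact n)"
    using rodrigues_factor_Suc[of n] by (simp only: mult.commute add.commute)
  then have "smult (2 * (real n + 1)) (rodrigues (Suc n) 0)
      = smult (1 / (2 ^ n * fact n)) ([:-1, 0, 1:] ^ Suc n)"
    unfolding rodrigues_def smult_smult by simp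
  also have "\<dots> = [:-1, 0, 1:] * rodrigues n 0"
    by (simp only: rodrigues_def power_Suc mult_smult_right funpow_0)
  finally show ?thesis .
qed

lemma rodrigues_Suc_1: "rodrigues (Suc n) 1 = [:0, 1:] * rodrigues n 0"
proof -
  let ?v = "[:-1, 0, 1:] :: real poly"
  have "pderiv (?v ^ Suc n) = smult (1 + real n) (?v ^ n) * [:0, 2:]"
    by (simp only: pderiv_power_Suc) (simp add: pderiv_pCons)
  also have "[:0, 2:] = smult 2 [:0, 1 :: real:]" by simp
  finally have "pderiv (?v ^ Suc n) = smult (2 * (1 + real n)) ([:0, 1:] * ?v ^ n)"
    by (simp only: mult_smult_right mult_smult_left smult_smult mult.commute)
  then have "rodrigues (Suc n) 1 =
      smult (1 / (2 ^ Suc n * fact (Suc n)) * (2 * (1 + real n))) ([:0, 1:] * ?v ^ n)"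
    by (simp only: rodrigues_def One_nat_def funpow.simps o_apply id_apply smult_smult)
  also note rodrigues_factor_Suc
  finally show ?thesis
    by (simp only: rodrigues_def mult_smult_right funpow_0)
qed

text \<open>The derivative of \<open>(x\<^sup>2 - 1)\<^bsup>n+1\<^esup>\<close> is \<open>2 (n + 1) x (x\<^sup>2 - 1)\<^sup>n\<close>, and the normalization absorbs the
factor; the rest is Leibniz' rule for a product with \<open>x\<close>. Together with the following identity this
yields Bonnet's recursion.\<close>

lemma rodrigues_Suc_Suc:
  "rodrigues (Suc n) (Suc j) = [:0, 1:] * rodrigues n j + smult (real j) (rodrigues n (j - 1))"
proof (induction j)
  case 0
  then show ?case using rodrigues_Suc_1 by simp
next
  case (Suc j)
  have j: "smult (real j) (rodrigues n (Suc (j - Suc 0))) = smult (real j) (rodrigues n j)"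
    by (cases j) simp_all
  have "rodrigues (Suc n) (Suc (Suc j)) = pderiv (rodrigues (Suc n) (Suc j))"
    by (simp add: pderiv_rodrigues)
  also have "\<dots> = [:0, 1:] * rodrigues n (Suc j) + rodrigues n j + smult (real j) (rodrigues n j)"
    by (simp only: Suc.IH pderiv_add pderiv_mult pderiv_smult pderiv_rodrigues)
      (simp add: pderiv_pCons j)
  also have "\<dots> = [:0, 1:] * rodrigues n (Suc j) + smult (real (Suc j)) (rodrigues n j)"
    by (simp add: smult_add_left)
  finally show ?case by simp
qed

text \<open>For \<open>j = n + 1\<close> this is the classical \<open>L'\<^sub>n\<^sub>+\<^sub>2 = (2 n + 3) L\<^sub>n\<^sub>+\<^sub>1 + L'\<^sub>n\<close>. Differentiating \<open>j\<close> times,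
it suffices to treat \<open>j = 0\<close>, where one writes \<open>x\<^sup>2 = (x\<^sup>2 - 1) + 1\<close>.\<close>

lemma rodrigues_three_term:
  "rodrigues (Suc (Suc n)) (Suc (Suc j)) =
     smult (2 * real n + 3) (rodrigues (Suc n) j) + rodrigues n j"
proof (induction j)
  case 0
  have "rodrigues (Suc (Suc n)) (Suc (Suc 0)) =
      [:0, 1:] * ([:0, 1:] * rodrigues n 0) + rodrigues (Suc n) 0"
    by (simp only: rodrigues_Suc_Suc[of "Suc n" "Suc 0"] rodrigues_Suc_1[simplified]) simp
  also have "[:0, 1:] * ([:0, 1:] * rodrigues n 0) = [:-1, 0, 1:] * rodrigues n 0 + rodrigues n 0"
    by (rule poly_ext) (simp add: algebra_simps)
  also have "\<dots> = smult (2 * (real n + 1)) (rodrigues (Suc n) 0) + rodrigues n 0"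
    by (simp only: rodrigues_Suc_0)
  finally show ?case
    by (intro poly_ext) (simp add: algebra_simps)
next
  case (Suc j)
  then show ?case
    by (metis pderiv_rodrigues pderiv_add pderiv_smult)
qed

text \<open>With \<open>u = (x\<^sup>2 - 1)\<^sup>n\<close> one has \<open>(x\<^sup>2 - 1) u' = 2 n x u\<close>; differentiating this relation \<open>j + 1\<close> times
gives the equation. For \<open>j = n\<close> it is Legendre's equation, for smaller \<open>j\<close> a Gegenbauer equation with
negative parameter.\<close>

lemma rodrigues_ode:
  "poly (rodrigues n (Suc (Suc j))) x * (x\<^sup>2 - 1) =
     2 * (real n - real j - 1) * x * poly (rodrigues n (Suc j)) x
     + (2 * real n - real j) * (real j + 1) * poly (rodrigues n j) x"
proof -
  let ?Y = "rodrigues n"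
  \<comment> \<open>the first order equation \<open>(x\<^sup>2 - 1) D u = 2 n x u\<close>\<close>
  have 1: "[:-1, 0, 1:] * ?Y (Suc 0) = smult (2 * real n) ([:0, 1:] * ?Y 0)"
  proof (cases n)
    case 0
    then show ?thesis by (simp add: rodrigues_def pderiv_pCons)
  next
    case (Suc m)
    then show ?thesis
      using rodrigues_Suc_0[of m] rodrigues_Suc_1[of m]
      by (simp only: One_nat_def of_nat_Suc add.commute mult_smult_right [symmetric])
        (simp only: mult.left_commute)
  qed
  have *: "[:-1, 0, 1:] * ?Y (Suc (Suc j)) =
     smult (2 * (real n - real j - 1)) ([:0, 1:] * ?Y (Suc j))
     + smult ((2 * real n - real j) * (real j + 1)) (?Y j)" for j
  proof (induction j)
    case 0
    have "pderiv ([:-1, 0, 1:] * ?Y (Suc 0)) = pderiv (smult (2 * real n) ([:0, 1:] * ?Y 0))"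
      by (simp only: 1)
    then have "[:-1, 0, 1:] * ?Y (Suc (Suc 0)) + ?Y (Suc 0) * [:0, 2:] =
        smult (2 * real n) ([:0, 1:] * ?Y (Suc 0) + ?Y 0)"
      by (simp only: pderiv_mult pderiv_smult pderiv_rodrigues) (simp add: pderiv_pCons)
    then have "poly ([:-1, 0, 1:] * ?Y (Suc (Suc 0)) + ?Y (Suc 0) * [:0, 2:]) x =
        poly (smult (2 * real n) ([:0, 1:] * ?Y (Suc 0) + ?Y 0)) x" for x
      by simp
    then show ?case
      by (intro poly_ext) (simp add: algebra_simps)
  next
    case (Suc j)
    have "pderiv ([:-1, 0, 1:] * ?Y (Suc (Suc j))) =
      pderiv (smult (2 * (real n - real j - 1)) ([:0, 1:] * ?Y (Suc j))
     + smult ((2 * real n - real j) * (real j + 1)) (?Y j))"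
      by (simp only: Suc)
    then have "[:-1, 0, 1:] * ?Y (Suc (Suc (Suc j))) + ?Y (Suc (Suc j)) * [:0, 2:] =
        smult (2 * (real n - real j - 1)) ([:0, 1:] * ?Y (Suc (Suc j)) + ?Y (Suc j))
        + smult ((2 * real n - real j) * (real j + 1)) (?Y (Suc j))"
      by (simp only: pderiv_mult pderiv_smult pderiv_rodrigues pderiv_add) (simp add: pderiv_pCons)
    then have "poly ([:-1, 0, 1:] * ?Y (Suc (Suc (Suc j))) + ?Y (Suc (Suc j)) * [:0, 2:]) x =
        poly (smult (2 * (real n - real j - 1)) ([:0, 1:] * ?Y (Suc (Suc j)) + ?Y (Suc j))
        + smult ((2 * real n - real j) * (real j + 1)) (?Y (Suc j))) x" for x
      by simp
    then show ?case
      by (intro poly_ext) (simp add: algebra_simps)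
  qed
  have "poly ([:-1, 0, 1:] * ?Y (Suc (Suc j))) x =
    poly (smult (2 * (real n - real j - 1)) ([:0, 1:] * ?Y (Suc j))
     + smult ((2 * real n - real j) * (real j + 1)) (?Y j)) x"
    by (simp only: *)
  then show ?thesis by (simp add: power2_eq_square algebra_simps)
qed

text \<open>Eliminating the iterated integral \<open>rodrigues (Suc n) n\<close> from the two preceding identities leaves a
relation between three consecutive polynomials of Rodrigues type.\<close>

lemma rodrigues_bonnet:
  "(real n + 2) * poly (rodrigues (Suc (Suc n)) (Suc (Suc n))) x =
     (2 * real n + 3) * x * poly (rodrigues (Suc n) (Suc n)) x
     - (real n + 1) * poly (rodrigues n n) x"
proof -
  have p: "poly (rodrigues (Suc (Suc n)) (Suc (Suc n))) x
      = x * poly (rodrigues (Suc n) (Suc n)) x + (real n + 1) * poly (rodrigues (Suc n) n) x"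
    by (simp add: rodrigues_Suc_Suc[of "Suc n" "Suc n"] algebra_simps)
  have q: "poly (rodrigues (Suc (Suc n)) (Suc (Suc n))) x
      = (2 * real n + 3) * poly (rodrigues (Suc n) n) x + poly (rodrigues n n) x"
    by (simp add: rodrigues_three_term)
  have "(2 * real n + 3) * poly (rodrigues (Suc (Suc n)) (Suc (Suc n))) x
      - (real n + 1) * poly (rodrigues (Suc (Suc n)) (Suc (Suc n))) x
      = (2 * real n + 3) * (x * poly (rodrigues (Suc n) (Suc n)) x)
        - (real n + 1) * poly (rodrigues n n) x"
    by (subst p, subst q) (simp add: algebra_simps)
  then show ?thesis by (simp add: algebra_simps)
qed

lemma rodrigues_eq_legendre: "rodrigues n n = legendre_poly n"
proof (induction n rule: legendre_poly.induct)
  case 1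
  then show ?case by (simp add: rodrigues_0_0)
next
  case 2
  then show ?case using rodrigues_Suc_1[of 0] by (simp add: rodrigues_0_0)
next
  case (3 n)
  have "poly (rodrigues (Suc (Suc n)) (Suc (Suc n))) x = poly (legendre_poly (Suc (Suc n))) x" for x
    using rodrigues_bonnet[of n x] 3 by (simp add: field_simps)
  then show ?case by (intro poly_ext)
qed

text \<open>Each differentiation lowers the multiplicity of a zero by at most one.\<close>

lemma power_dvd_higher_pderiv:
  fixes p :: "real poly"
  assumes "j \<le> n"
  shows "p ^ (n - j) dvd (pderiv ^^ j) (p ^ n)"
  using assms
proof (induction j)
  case (Suc j)
  then obtain q where q: "(pderiv ^^ j) (p ^ n) = p ^ (n - j) * q" by auto
  have s: "n - j = Suc (n - Suc j)" using Suc.prems by simp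
  have "(pderiv ^^ Suc j) (p ^ n) = pderiv (p ^ Suc (n - Suc j) * q)"
    using q s by simp
  also have "\<dots> = p ^ (n - Suc j) * (p * pderiv q + smult (real (Suc (n - Suc j))) (q * pderiv p))"
    by (simp only: pderiv_mult pderiv_power_Suc) (simp add: algebra_simps)
  finally show ?case by simp
qed simp

lemma rodrigues_endpoints:
  assumes "j < n"
  shows "poly (rodrigues n j) 1 = 0" "poly (rodrigues n j) (-1) = 0"
proof -
  have "[:-1, 0, 1:] dvd ([:-1, 0, 1:] :: real poly) ^ (n - j)"
    using assms by (simp add: dvd_power)
  also have "\<dots> dvd (pderiv ^^ j) ([:-1, 0, 1:] ^ n)"
    using assms by (intro power_dvd_higher_pderiv) simp
  finally obtain q where "(pderiv ^^ j) ([:-1, 0, 1:] ^ n) = [:-1, 0, 1 :: real:] * q" by auto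
  then show "poly (rodrigues n j) 1 = 0" "poly (rodrigues n j) (-1) = 0"
    by (simp_all add: rodrigues_def)
qed

section \<open>Pointwise bounds from Sonin functions\<close>

text \<open>Differentiating \<open>y\<^sup>2 + (1 - x\<^sup>2) y'\<^sup>2 / \<nu>\<close> and replacing \<open>y''\<close> by means of the differential equation
leaves a multiple of \<open>x y'\<^sup>2\<close>. The sign of the factor \<open>2 j + 1 - 2 n\<close> is the whole point: it is
positive for \<open>j = n\<close> and negative for \<open>j < n\<close>.\<close>

lemma DERIV_sonin:
  fixes n j :: nat and x :: real
  defines "\<nu> \<equiv> (2 * real n - real j) * (real j + 1)"
  assumes "\<nu> \<noteq> 0"
  shows "((\<lambda>x. (poly (rodrigues n j) x)\<^sup>2 + (1 - x\<^sup>2) * (poly (rodrigues n (Suc j)) x)\<^sup>2 / \<nu>)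
    has_real_derivative
      (2 * (2 * real j + 1 - 2 * real n) / \<nu> * (poly (rodrigues n (Suc j)) x)\<^sup>2) * x) (at x)"
proof -
  let ?y = "poly (rodrigues n j) x"
  let ?y1 = "poly (rodrigues n (Suc j)) x"
  let ?y2 = "poly (rodrigues n (Suc (Suc j))) x"
  have ode: "?y2 * (x\<^sup>2 - 1) = 2 * (real n - real j - 1) * x * ?y1 + \<nu> * ?y"
    unfolding \<nu>_def by (rule rodrigues_ode)
  have "((\<lambda>x. (poly (rodrigues n j) x)\<^sup>2) has_real_derivative 2 * ?y * ?y1) (at x)"
    by (auto intro!: derivative_eq_intros simp: pderiv_rodrigues)
  moreover have "((\<lambda>x. (1 - x\<^sup>2) * (poly (rodrigues n (Suc j)) x)\<^sup>2) has_real_derivative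
      (1 - x\<^sup>2) * (2 * ?y1 * ?y2) - 2 * x * ?y1\<^sup>2) (at x)"
    by (auto intro!: derivative_eq_intros simp: pderiv_rodrigues algebra_simps)
  ultimately have "((\<lambda>x. (poly (rodrigues n j) x)\<^sup>2 + (1 - x\<^sup>2) * (poly (rodrigues n (Suc j)) x)\<^sup>2 / \<nu>)
    has_real_derivative
      2 * ?y * ?y1 + ((1 - x\<^sup>2) * (2 * ?y1 * ?y2) - 2 * x * ?y1\<^sup>2) / \<nu>) (at x)"
    by (intro DERIV_add DERIV_cdivide)
  moreover have "2 * ?y * ?y1 + ((1 - x\<^sup>2) * (2 * ?y1 * ?y2) - 2 * x * ?y1\<^sup>2) / \<nu>
     = (2 * (2 * real j + 1 - 2 * real n) / \<nu> * ?y1\<^sup>2) * x"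
  proof -
    have "(1 - x\<^sup>2) * (2 * ?y1 * ?y2) = - (2 * ?y1) * (?y2 * (x\<^sup>2 - 1))"
      by (simp add: algebra_simps)
    then have "2 * ?y * ?y1 * \<nu> + ((1 - x\<^sup>2) * (2 * ?y1 * ?y2) - 2 * x * ?y1\<^sup>2)
      = 2 * (2 * real j + 1 - 2 * real n) * ?y1\<^sup>2 * x"
      unfolding ode by (simp add: algebra_simps power2_eq_square)
    then show ?thesis using assms(2) by (simp add: field_simps)
  qed
  ultimately show ?thesis by simp
qed

lemma monotone_from_zero:
  fixes S :: "real \<Rightarrow> real" and c :: "real \<Rightarrow> real"
  assumes "\<And>x. (S has_real_derivative c x * x) (at x)" "\<And>x. c x \<ge> 0" and "\<bar>x\<bar> \<le> b"
  shows "S 0 \<le> S x" and "S x \<le> max (S b) (S (- b))"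
proof -
  have up: "S u \<le> S v" if "0 \<le> u" "u \<le> v" for u v
    by (rule DERIV_nonneg_imp_nondecreasing[OF \<open>u \<le> v\<close>])
      (use assms that in \<open>meson mult_nonneg_nonneg order_trans\<close>)
  have down: "S v \<le> S u" if "u \<le> v" "v \<le> 0" for u v
    by (rule DERIV_nonpos_imp_nonincreasing[OF \<open>u \<le> v\<close>])
      (use assms that in \<open>meson mult_nonneg_nonpos order_trans\<close>)
  show "S 0 \<le> S x" using up[of 0 x] down[of x 0] by linarith
  show "S x \<le> max (S b) (S (- b))"
    using up[of x b] down[of "-b" x] assms(3) by (cases "x \<ge> 0") auto
qed

lemma poly_legendre_poly_minus_1: "poly (legendre_poly n) (-1) = (-1) ^ n"
  by (induction n rule: legendre_poly.induct) (simp_all add: field_simps)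

lemma abs_legendre_le_1:
  assumes "\<bar>x\<bar> \<le> 1"
  shows "\<bar>poly (legendre_poly n) x\<bar> \<le> 1"
proof (cases "n = 0")
  case False
  define \<nu> where "\<nu> = (2 * real n - real n) * (real n + 1)"
  define S where "S = (\<lambda>x. (poly (rodrigues n n) x)\<^sup>2 + (1 - x\<^sup>2) * (poly (rodrigues n (Suc n)) x)\<^sup>2 / \<nu>)"
  have nu: "\<nu> > 0" using False by (simp add: \<nu>_def)
  have "S x \<le> max (S 1) (S (-1))"
  proof (rule monotone_from_zero(2)[OF _ _ assms])
    show "(S has_real_derivative (2 * (2 * real n + 1 - 2 * real n) / \<nu> * (poly (rodrigues n (Suc n)) x)\<^sup>2) * x) (at x)" for x
      unfolding S_def \<nu>_def by (rule DERIV_sonin) (use nu in \<open>simp only: \<nu>_def\<close>)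
  qed (use nu in simp)
  also have "\<dots> = 1"
    by (simp add: S_def rodrigues_eq_legendre poly_legendre_poly_1 poly_legendre_poly_minus_1 flip: power_mult)
  finally have "S x \<le> 1" .
  moreover have "(poly (legendre_poly n) x)\<^sup>2 \<le> S x"
    using nu assms by (simp add: S_def rodrigues_eq_legendre abs_square_le_1)
  ultimately show ?thesis by (simp flip: abs_square_le_1)
qed simp

text \<open>For \<open>j < n\<close> the Sonin function is largest at the origin, where it involves only the values of two
consecutive derivatives.\<close>

lemma rodrigues_le_at_zero:
  assumes "\<bar>x\<bar> \<le> 1" "j < n"
  shows "(poly (rodrigues n j) x)\<^sup>2 \<le> (poly (rodrigues n j) 0)\<^sup>2
    + (poly (rodrigues n (Suc j)) 0)\<^sup>2 / ((2 * real n - real j) * (real j + 1))"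
proof -
  define \<nu> where "\<nu> = (2 * real n - real j) * (real j + 1)"
  define S where "S = (\<lambda>x. (poly (rodrigues n j) x)\<^sup>2 + (1 - x\<^sup>2) * (poly (rodrigues n (Suc j)) x)\<^sup>2 / \<nu>)"
  have nu: "\<nu> > 0" using assms(2) by (simp add: \<nu>_def)
  have "(\<lambda>x. - S x) 0 \<le> (\<lambda>x. - S x) x"
  proof (rule monotone_from_zero(1)[OF _ _ assms(1)])
    show "((\<lambda>x. - S x) has_real_derivative
        (2 * (2 * real n - 1 - 2 * real j) / \<nu> * (poly (rodrigues n (Suc j)) x)\<^sup>2) * x) (at x)" for x
    proof -
      have nz: "(2 * real n - real j) * (real j + 1) \<noteq> 0"
        using nu unfolding \<nu>_def by linarith
      show ?thesis
        unfolding S_def \<nu>_def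
        by (rule DERIV_cong[OF DERIV_minus[OF DERIV_sonin[OF nz]]])
          (simp add: divide_inverse algebra_simps)
    qed
  qed (use nu assms in simp)
  moreover have "(poly (rodrigues n j) x)\<^sup>2 \<le> S x"
    using nu assms by (simp add: S_def abs_square_le_1)
  ultimately show ?thesis by (simp add: S_def \<nu>_def)
qed

section \<open>Values at the origin and the size of the iterated integrals\<close>

definition step_two_prod :: "real \<Rightarrow> nat \<Rightarrow> real" where
  "step_two_prod a k = (\<Prod>s=1..k. a + 2 * real s)"

lemma step_two_prod_0 [simp]: "step_two_prod a 0 = 1"
  by (simp add: step_two_prod_def)

lemma step_two_prod_Suc: "step_two_prod a (Suc k) = step_two_prod a k * (a + 2 * real k + 2)"
  by (simp add: step_two_prod_def algebra_simps)

lemma step_two_prod_Suc_shift: "step_two_prod a (Suc k) = (a + 2) * step_two_prod (a + 2) k"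
proof -
  have "step_two_prod a (Suc k) = (a + 2) * (\<Prod>s=Suc 1..Suc k. a + 2 * real s)"
    unfolding step_two_prod_def by (subst prod.atLeast_Suc_atMost) auto
  also have "(\<Prod>s=Suc 1..Suc k. a + 2 * real s) = step_two_prod (a + 2) k"
    unfolding step_two_prod_def by (subst prod.shift_bounds_cl_Suc_ivl) (simp add: algebra_simps)
  finally show ?thesis .
qed

lemma step_two_prod_pos: "a > -2 \<Longrightarrow> step_two_prod a k > 0"
  unfolding step_two_prod_def by (intro prod_pos) auto

text \<open>Compares a product over one parity class with the product over the other one. Squaring makes it
possible to use \<open>b (b + 2) \<le> (b + 1)\<^sup>2\<close> for neighbouring factors, and the two end factors are what is
left over.\<close>

lemma step_two_prod_log_concave:
  assumes "a \<ge> 0"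
  shows "(step_two_prod a (Suc k))\<^sup>2 \<le> (step_two_prod (a + 1) k)\<^sup>2 * (a + 2) * (a + 2 * real k + 2)"
proof (induction k)
  case 0
  then show ?case by (simp add: step_two_prod_Suc power2_eq_square)
next
  case (Suc k)
  let ?b = "a + 2 * real k + 2"
  let ?P = "step_two_prod (a + 1) k"
  have b: "?b > 0" using assms by simp
  have "(step_two_prod a (Suc (Suc k)))\<^sup>2 = (step_two_prod a (Suc k))\<^sup>2 * (?b + 2)\<^sup>2"
    by (simp only: step_two_prod_Suc[of a "Suc k"] power_mult_distrib) (simp add: algebra_simps)
  also have "\<dots> \<le> (?P\<^sup>2 * (a + 2) * ?b) * (?b + 2)\<^sup>2"
    by (intro mult_right_mono Suc.IH) simp
  also have "\<dots> = (?P\<^sup>2 * (a + 2) * (?b + 2)) * (?b * (?b + 2))"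
    by (simp add: power2_eq_square algebra_simps)
  also have "\<dots> \<le> (?P\<^sup>2 * (a + 2) * (?b + 2)) * (?b + 1)\<^sup>2"
    using assms b by (intro mult_left_mono) (auto simp: power2_eq_square algebra_simps)
  also have "\<dots> = (step_two_prod (a + 1) (Suc k))\<^sup>2 * (a + 2) * (?b + 2)"
    by (simp only: step_two_prod_Suc[of "a + 1" k] power_mult_distrib) (simp add: algebra_simps)
  finally show ?case by (simp add: algebra_simps)
qed

text \<open>The quotient \<open>(2 i - 1)!! / (2 i)!!\<close> of Wallis' product, which is \<open>\<bar>L\<^bsub>2 i\<^esub>(0)\<bar>\<close>.\<close>

definition wallis_ratio :: "nat \<Rightarrow> real" where
  "wallis_ratio i = (\<Prod>s=1..i. (2 * real s - 1) / (2 * real s))"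

lemma wallis_ratio_Suc: "wallis_ratio (Suc i) = wallis_ratio i * ((2 * real i + 1) / (2 * real i + 2))"
  by (simp add: wallis_ratio_def algebra_simps)

text \<open>By Wallis' product the left-hand side increases to \<open>2 / \<pi>\<close>. To get an upper bound by induction the
shift \<open>1/2\<close> is enlarged to \<open>3/5\<close>: the resulting sequence decreases from \<open>i = 1\<close> on, and its first
value \<open>13/20\<close> is below \<open>A\<^sup>2\<close>.\<close>

lemma wallis_ratio_bound: "(wallis_ratio i)\<^sup>2 * (2 * real i + 1/2) \<le> const_A\<^sup>2"
proof (cases i)
  case 0
  then show ?thesis by (simp add: wallis_ratio_def const_A_def power2_eq_square)
next
  case (Suc k)
  have "(wallis_ratio (Suc k))\<^sup>2 * (2 * real (Suc k) + 3/5) \<le> 13/20" for k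
  proof (induction k)
    case 0
    then show ?case by (simp add: wallis_ratio_def power2_eq_square)
  next
    case (Suc k)
    define m where "m = 2 * real (Suc k)"
    have m: "2 * real (Suc (Suc k)) + 3/5 = m + 13/5" by (simp add: m_def)
    have w: "wallis_ratio (Suc (Suc k)) = wallis_ratio (Suc k) * ((m + 1) / (m + 2))"
      by (simp only: wallis_ratio_Suc[of "Suc k"] m_def)
    have "(wallis_ratio (Suc (Suc k)))\<^sup>2 * (2 * real (Suc (Suc k)) + 3/5)
        = (wallis_ratio (Suc k))\<^sup>2 * ((m + 1)\<^sup>2 * (m + 13/5) / (m + 2)\<^sup>2)"
      unfolding m w by (simp add: power_mult_distrib power_divide)
    also have "(m + 1)\<^sup>2 * (m + 13/5) / (m + 2)\<^sup>2 \<le> m + 3/5"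
      by (simp add: m_def divide_simps power2_eq_square) (simp add: algebra_simps)
    then have "(wallis_ratio (Suc k))\<^sup>2 * ((m + 1)\<^sup>2 * (m + 13/5) / (m + 2)\<^sup>2)
        \<le> (wallis_ratio (Suc k))\<^sup>2 * (m + 3/5)"
      by (rule mult_left_mono) simp
    also note Suc.IH[folded m_def]
    finally show ?case .
  qed
  from this[of k] Suc have "(wallis_ratio i)\<^sup>2 * (2 * real i + 3/5) \<le> 13/20" by simp
  moreover have "(wallis_ratio i)\<^sup>2 * (2 * real i + 1/2) \<le> (wallis_ratio i)\<^sup>2 * (2 * real i + 3/5)"
    by (intro mult_left_mono) auto
  moreover have "13/20 \<le> const_A\<^sup>2" by (simp add: const_A_def power2_eq_square)
  ultimately show ?thesis by linarith
qed

lemma rodrigues_at_0_step: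
  "poly (rodrigues n (Suc (Suc j))) 0 = - ((2 * real n - real j) * (real j + 1)) * poly (rodrigues n j) 0"
  using rodrigues_ode[of n j 0] by simp

lemma rodrigues_at_0_odd: "poly (rodrigues n (Suc (2 * i))) 0 = 0"
proof (induction i)
  case 0
  show ?case
  proof (cases n)
    case 0
    then show ?thesis by (simp add: rodrigues_def)
  next
    case (Suc m)
    then show ?thesis using rodrigues_Suc_1[of m] by simp
  qed
next
  case (Suc i)
  then show ?case using rodrigues_at_0_step[of n "Suc (2 * i)"] by simp
qed

lemma rodrigues_0_at_0: "\<bar>poly (rodrigues n 0) 0\<bar> = 1 / step_two_prod 0 n"
proof (induction n)
  case 0
  then show ?case by (simp add: rodrigues_0_0)
next
  case (Suc n)
  have "poly (smult (2 * (real n + 1)) (rodrigues (Suc n) 0)) 0 = poly ([:-1, 0, 1:] * rodrigues n 0) 0"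
    by (simp only: rodrigues_Suc_0)
  then have "\<bar>2 * (real n + 1) * poly (rodrigues (Suc n) 0) 0\<bar> = \<bar>poly (rodrigues n 0) 0\<bar>"
    by simp
  then have "2 * (real n + 1) * \<bar>poly (rodrigues (Suc n) 0) 0\<bar> = 1 / step_two_prod 0 n"
    using Suc.IH by (simp add: abs_mult)
  then show ?case
    using step_two_prod_pos[of 0 n] by (simp add: step_two_prod_Suc divide_simps mult_ac)
qed

text \<open>At the origin the differential equation is a two-term recursion in \<open>j\<close>, which solves to
\<open>(2 i - 1)!! / (2 n - 2 i)!!\<close>.\<close>

lemma rodrigues_at_0_even:
  assumes "2 * i \<le> n"
  shows "\<bar>poly (rodrigues n (2 * i)) 0\<bar> = wallis_ratio i / step_two_prod (2 * real i) (n - 2 * i)"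
  using assms
proof (induction i)
  case 0
  then show ?case by (simp add: rodrigues_0_at_0 wallis_ratio_def)
next
  case (Suc i)
  define k where "k = n - 2 * Suc i"
  have k: "n - 2 * i = Suc (Suc k)" "real n = 2 * real i + 2 + real k"
    using Suc.prems by (auto simp: k_def)
  have pos: "step_two_prod (2 * real i + 2) k > 0" by (intro step_two_prod_pos) simp
  have "\<bar>poly (rodrigues n (2 * Suc i)) 0\<bar>
      = (2 * real n - 2 * real i) * (2 * real i + 1) * \<bar>poly (rodrigues n (2 * i)) 0\<bar>"
    using rodrigues_at_0_step[of n "2 * i"] k(2) by (simp add: abs_mult)
  also have "\<dots> = (2 * real n - 2 * real i) * (2 * real i + 1)
      * (wallis_ratio i / step_two_prod (2 * real i) (Suc (Suc k)))"
    using Suc k(1) by simp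
  \<comment> \<open>passing from \<open>i\<close> to \<open>i + 1\<close> removes the first and the last factor of the product\<close>
  also have "step_two_prod (2 * real i) (Suc (Suc k))
      = (2 * real i + 2) * step_two_prod (2 * real i + 2) k * (2 * real n - 2 * real i)"
    by (simp add: step_two_prod_Suc_shift[of _ "Suc k"] step_two_prod_Suc[of _ k] k(2) algebra_simps)
  also have "(2 * real n - 2 * real i) * (2 * real i + 1) * (wallis_ratio i /
      ((2 * real i + 2) * step_two_prod (2 * real i + 2) k * (2 * real n - 2 * real i)))
      = wallis_ratio (Suc i) / step_two_prod (2 * real i + 2) k"
    using pos k(2) by (simp add: wallis_ratio_Suc divide_simps) 
  finally show ?case by (simp add: k_def algebra_simps)
qed

text \<open>Of the two values at the origin in Sonin's bound one vanishes by parity. For even \<open>j\<close> the other one is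
the value of the polynomial itself, and the bound is immediate. For odd \<open>j\<close> it is the value of the
derivative, which runs through the other parity class, and \<open>step_two_prod_log_concave\<close> shows that
the same formula still dominates.\<close>

lemma rodrigues_bound:
  assumes "\<bar>x\<bar> \<le> 1" "j < n"
  shows "\<bar>poly (rodrigues n j) x\<bar> \<le> const_A / (sqrt (real j + 1/2) * step_two_prod (real j) (n - j))"
proof -
  let ?P = "step_two_prod (real j) (n - j)"
  have P: "?P > 0" by (intro step_two_prod_pos) simp
  have A: "const_A > 0" by (simp add: const_A_def)
  have sonin: "(poly (rodrigues n j) x)\<^sup>2 \<le> (poly (rodrigues n j) 0)\<^sup>2
    + (poly (rodrigues n (Suc j)) 0)\<^sup>2 / ((2 * real n - real j) * (real j + 1))"
    by (rule rodrigues_le_at_zero[OF assms])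
  have "(poly (rodrigues n j) x)\<^sup>2 \<le> const_A\<^sup>2 / ((real j + 1/2) * ?P\<^sup>2)"
  proof (cases "even j")
    case True
    then obtain i where i: "j = 2 * i" by blast
    have "(poly (rodrigues n j) 0)\<^sup>2 = (wallis_ratio i)\<^sup>2 / ?P\<^sup>2"
      using rodrigues_at_0_even[of i n] assms(2) i
      by (metis less_imp_le power2_abs power_divide of_nat_mult of_nat_numeral)
    also have "\<dots> \<le> (const_A\<^sup>2 / (2 * real i + 1/2)) / ?P\<^sup>2"
      using wallis_ratio_bound[of i] by (intro divide_right_mono) (auto simp: field_simps)
    finally show ?thesis
      using sonin rodrigues_at_0_odd[of n i] i by (simp add: field_simps)
  next
    case False
    then obtain i where i: "j = Suc (2 * i)" by (metis oddE Suc_eq_plus1)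
    define k where "k = n - Suc j"
    have k: "n - j = Suc k" "real n = real j + real k + 1" using assms(2) by (auto simp: k_def)
    define Q where "Q = step_two_prod (real j + 1) k"
    have Q: "Q > 0" unfolding Q_def by (intro step_two_prod_pos) simp
    define D where "D = (real j + 2 * real k + 2) * (real j + 1)"
    have D: "D > 0" unfolding D_def by simp
    have j1: "2 * Suc i = Suc j" "2 * real (Suc i) = real j + 1" using i by auto
    have "(poly (rodrigues n (Suc j)) 0)\<^sup>2 = (wallis_ratio (Suc i))\<^sup>2 / Q\<^sup>2"
      using rodrigues_at_0_even[of "Suc i" n] assms(2) unfolding j1 Q_def k_def
      by (metis Suc_leI power2_abs power_divide)
    also have "\<dots> \<le> (const_A\<^sup>2 / (real j + 3/2)) / Q\<^sup>2"
      using wallis_ratio_bound[of "Suc i"] unfolding j1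
      by (intro divide_right_mono) (auto simp: field_simps)
    finally have "(poly (rodrigues n (Suc j)) 0)\<^sup>2 / D \<le> const_A\<^sup>2 / ((real j + 3/2) * Q\<^sup>2 * D)"
      using D by (simp add: divide_right_mono mult.assoc flip: divide_divide_eq_left)
    also have "\<dots> \<le> const_A\<^sup>2 / ((real j + 1/2) * ?P\<^sup>2)"
    proof (rule divide_left_mono)
      have "(real j + 1/2) * ?P\<^sup>2 \<le> (real j + 1/2) * (Q\<^sup>2 * (real j + 2) * (real j + 2 * real k + 2))"
        unfolding k(1) Q_def by (intro mult_left_mono step_two_prod_log_concave) auto
      also have "\<dots> = Q\<^sup>2 * (real j + 2 * real k + 2) * ((real j + 1/2) * (real j + 2))"
        by (simp add: algebra_simps)
      also have "\<dots> \<le> Q\<^sup>2 * (real j + 2 * real k + 2) * ((real j + 3/2) * (real j + 1))"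
        by (intro mult_left_mono) (auto simp: field_simps)
      also have "\<dots> = (real j + 3/2) * Q\<^sup>2 * D" by (simp add: D_def)
      finally show "(real j + 1/2) * ?P\<^sup>2 \<le> (real j + 3/2) * Q\<^sup>2 * D" .
    qed (use P Q D in auto)
    moreover have "(2 * real n - real j) * (real j + 1) = D" by (simp add: D_def k(2) algebra_simps)
    moreover have "poly (rodrigues n j) 0 = 0" unfolding i by (rule rodrigues_at_0_odd)
    ultimately show ?thesis using sonin by simp
  qed
  also have "\<dots> = (const_A / (sqrt (real j + 1/2) * ?P))\<^sup>2"
    by (simp add: power_divide power_mult_distrib)
  finally have "\<bar>poly (rodrigues n j) x\<bar> \<le> \<bar>const_A / (sqrt (real j + 1/2) * ?P)\<bar>"
    by (simp only: abs_le_square_iff)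
  then show ?thesis using P A by simp
qed

section \<open>Summation of the coefficient bounds\<close>

text \<open>The exact sum of \<open>(n + 1/2) (n - k - 1)!! / (n + k)!!\<close> over one parity class of \<open>n\<close>, with
\<open>k = r + 1\<close>, is a multiple of \<open>(m + r + 1/2) (m - 1)!! / (m + 2 r)!!\<close> for \<open>m + k\<close> the first index; the
formula below arises by replacing the Wallis quotient \<open>(m - 1)!! / m!!\<close> by \<open>1 / sqrt (m + 1/2)\<close>.\<close>

definition tail_bound :: "nat \<Rightarrow> real \<Rightarrow> real" where
  "tail_bound r m = (m + real r + 1/2) / (sqrt (m + 1/2) * step_two_prod m r)"

text \<open>With \<open>w m\<close> in place of \<open>1 / sqrt (m + 1/2)\<close>, where \<open>w (m + 2) = w m (m + 1) / (m + 2)\<close>, this would be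
an identity. The square root satisfies that recursion as an inequality in the right direction.\<close>

lemma tail_bound_telescope:
  assumes "m \<ge> 0"
  shows "(2 * real r - 1) * ((m + real r + 3/2) / (sqrt (m + 1/2) * step_two_prod m (Suc r)))
    \<le> tail_bound r m - tail_bound r (m + 2)"
proof -
  let ?P = "step_two_prod m (Suc r)" and ?s = "sqrt (m + 1/2)"
  have P: "?P > 0" using assms by (intro step_two_prod_pos) simp
  have s: "?s > 0" using assms by simp
  have P0: "step_two_prod m r > 0" using assms by (intro step_two_prod_pos) simp
  have P2: "step_two_prod (m + 2) r > 0" using assms by (intro step_two_prod_pos) simp
  have 1: "tail_bound r m = (m + real r + 1/2) * (m + 2 * real r + 2) / (?s * ?P)"
    using assms s P0 by (simp add: tail_bound_def step_two_prod_Suc divide_simps)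
  have "tail_bound r (m + 2) = (m + real r + 5/2) * (m + 2) / ?P * (1 / sqrt (m + 5/2))"
    using assms P2 by (simp add: tail_bound_def step_two_prod_Suc_shift divide_simps add_ac)
  also have "\<dots> \<le> (m + real r + 5/2) * (m + 2) / ?P * ((m + 1) / ((m + 2) * ?s))"
  proof (rule mult_left_mono)
    have "sqrt ((m + 1/2) * (m + 2)\<^sup>2) \<le> sqrt ((m + 5/2) * (m + 1)\<^sup>2)"
      using assms by (intro real_sqrt_le_mono) (simp add: power2_eq_square algebra_simps)
    then have "?s * (m + 2) \<le> sqrt (m + 5/2) * (m + 1)"
      using assms by (simp add: real_sqrt_mult)
    then show "1 / sqrt (m + 5/2) \<le> (m + 1) / ((m + 2) * ?s)"
      using assms s by (simp add: divide_simps mult_ac)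
  qed (use assms P in auto)
  also have "\<dots> = (m + real r + 5/2) * (m + 1) / (?s * ?P)"
    using assms by simp
  finally have 2: "tail_bound r (m + 2) \<le> (m + real r + 5/2) * (m + 1) / (?s * ?P)" .
  have "(2 * real r - 1) * ((m + real r + 3/2) / (?s * ?P))
      = (m + real r + 1/2) * (m + 2 * real r + 2) / (?s * ?P)
        - (m + real r + 5/2) * (m + 1) / (?s * ?P)"
    unfolding diff_divide_distrib[symmetric] times_divide_eq_right
    by (rule arg_cong2[where f = "(/)"]) (simp_all add: algebra_simps)
  with 1 2 show ?thesis by linarith
qed

lemma tail_bound_nonneg: "m \<ge> 0 \<Longrightarrow> tail_bound r m \<ge> 0"
  unfolding tail_bound_def using step_two_prod_pos[of m r]
  by (intro divide_nonneg_nonneg mult_nonneg_nonneg) auto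

text \<open>Steps of length two split the sum into two telescoping sums, which start at \<open>M\<close> and at \<open>M + 1\<close>.\<close>

lemma sum_tail_le:
  assumes "r \<ge> 1"
  shows "(\<Sum>i<K. (real (M + i) + real r + 3/2) /
      (sqrt (real (M + i) + 1/2) * step_two_prod (real (M + i)) (Suc r)))
    \<le> (tail_bound r (real M) + tail_bound r (real M + 1)) / (2 * real r - 1)"
proof -
  let ?q = "\<lambda>i. (real (M + i) + real r + 3/2) /
      (sqrt (real (M + i) + 1/2) * step_two_prod (real (M + i)) (Suc r))"
  have "(2 * real r - 1) * (\<Sum>i<K. ?q i)
    \<le> tail_bound r (real M) + tail_bound r (real M + 1)
      - tail_bound r (real (M + K)) - tail_bound r (real (M + K) + 1)"
  proof (induction K)
    case (Suc K)
    have "(2 * real r - 1) * ?q K \<le> tail_bound r (real (M + K)) - tail_bound r (real (M + K) + 2)"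
      by (rule tail_bound_telescope) simp
    with Suc show ?case by (simp add: algebra_simps)
  qed simp
  also have "\<dots> \<le> tail_bound r (real M) + tail_bound r (real M + 1)"
    using tail_bound_nonneg[of "real (M + K)" r] tail_bound_nonneg[of "real (M + K) + 1" r] by simp
  finally show ?thesis using assms by (simp add: field_simps)
qed

text \<open>The quotient of the first factors already provides the gain \<open>(m + 1/2) / (m + 3)\<close>; all other
factors compare monotonically. This gain pays for the numerator \<open>m + r + 3/2\<close> of
\<open>tail_bound r (m + 1)\<close> in the next lemma.\<close>

lemma prod_shift_compare:
  assumes "m \<ge> 0"
  shows "(\<Prod>j=1..Suc r. m + 2 * real j - 3/2) * (m + 3) \<le> step_two_prod (m + 1) (Suc r) * (m + 1/2)"
proof (induction r)
  case 0
  then show ?case by (simp add: step_two_prod_Suc algebra_simps)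
next
  case (Suc r)
  have "(\<Prod>j=1..Suc (Suc r). m + 2 * real j - 3/2) * (m + 3)
      = (\<Prod>j=1..Suc r. m + 2 * real j - 3/2) * (m + 3) * (m + 2 * real r + 5/2)"
    by (simp add: field_simps)
  also have "\<dots> \<le> step_two_prod (m + 1) (Suc r) * (m + 1/2) * (m + 2 * real r + 5)"
    using assms step_two_prod_pos[of "m + 1" "Suc r"]
    by (intro mult_mono Suc.IH) auto
  also have "\<dots> = step_two_prod (m + 1) (Suc (Suc r)) * (m + 1/2)"
    by (simp add: step_two_prod_Suc[of _ "Suc r"] algebra_simps)
  finally show ?case .
qed

lemma tail_bound_le:
  assumes "m \<ge> 0" "r \<ge> 1"
  defines "T \<equiv> (m + real r + 1/2) / (sqrt (m + 1/3) * (\<Prod>j=1..r. m + 2 * real j - 3/2))"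
  shows "tail_bound r m \<le> T" "tail_bound r (m + 1) \<le> T"
proof -
  let ?Q = "\<Prod>j=1..r. m + 2 * real j - 3/2"
  have Q: "?Q > 0"
    by (intro prod_pos) (use assms(1) in auto)
  have "?Q \<le> step_two_prod m r"
    unfolding step_two_prod_def by (intro prod_mono) (use assms(1) in auto)
  then show "tail_bound r m \<le> T"
    unfolding tail_bound_def T_def using assms(1) Q
    by (intro divide_left_mono mult_mono mult_pos_pos) (auto intro!: step_two_prod_pos)
  have P: "step_two_prod (m + 1) r > 0" using assms(1) by (intro step_two_prod_pos) simp
  obtain r' where r': "r = Suc r'" using assms(2) by (cases r) auto
  have "(m + real r + 3/2) * (m + 1/2) \<le> (m + real r + 1/2) * (m + 3)"
    using assms(1) by (simp add: field_simps)
  moreover have "?Q * (m + 3) \<le> step_two_prod (m + 1) r * (m + 1/2)"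
    using prod_shift_compare[OF assms(1)] unfolding r' .
  ultimately have "((m + real r + 3/2) * (m + 1/2)) * (?Q * (m + 3))
      \<le> ((m + real r + 1/2) * (m + 3)) * (step_two_prod (m + 1) r * (m + 1/2))"
    by (rule mult_mono) (use assms(1) Q in auto)
  then have "((m + real r + 3/2) * ?Q) * ((m + 1/2) * (m + 3))
      \<le> ((m + real r + 1/2) * step_two_prod (m + 1) r) * ((m + 1/2) * (m + 3))"
    by (simp only: mult_ac)
  then have "(m + real r + 3/2) * ?Q \<le> (m + real r + 1/2) * step_two_prod (m + 1) r"
    using assms(1) by (subst (asm) mult_le_cancel_right) auto
  then have "(m + real r + 3/2) / step_two_prod (m + 1) r \<le> (m + real r + 1/2) / ?Q"
    by (simp only: pos_divide_le_eq[OF P] times_divide_eq_left pos_le_divide_eq[OF Q])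
  moreover have "tail_bound r (m + 1) = ((m + real r + 3/2) / step_two_prod (m + 1) r) / sqrt (m + 3/2)"
    by (simp add: tail_bound_def algebra_simps)
  moreover have "T = ((m + real r + 1/2) / ?Q) / sqrt (m + 1/3)"
    by (simp add: T_def mult.commute)
  ultimately show "tail_bound r (m + 1) \<le> T"
    using Q assms(1) by (simp only:) (rule frac_le, auto)
qed

text \<open>For \<open>r = 1\<close> the numerator \<open>m + 3/2\<close> of \<open>tail_bound\<close> is smaller than the only linear factor \<open>m + 2\<close> of
the denominator, so that both disappear; hence the simpler form of the bound in that case.\<close>

lemma tail_bound_le_1:
  assumes "m \<ge> 0"
  shows "tail_bound 1 m \<le> 1 / sqrt (m + 1/3)" "tail_bound 1 (m + 1) \<le> 1 / sqrt (m + 1/3)"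
proof -
  have "tail_bound 1 m' \<le> 1 / sqrt (m + 1/3)" if "m' \<ge> m" for m'
  proof -
    have "tail_bound 1 m' = ((m' + 3/2) / (m' + 2)) / sqrt (m' + 1/2)"
      by (simp add: tail_bound_def step_two_prod_def add_ac)
    also have "\<dots> \<le> 1 / sqrt (m + 1/3)"
      using assms that by (intro frac_le) auto
    finally show ?thesis .
  qed
  then show "tail_bound 1 m \<le> 1 / sqrt (m + 1/3)" "tail_bound 1 (m + 1) \<le> 1 / sqrt (m + 1/3)" by auto
qed

section \<open>Absolutely continuous functions\<close>

lemma abs_continuous_onE:
  assumes "abs_continuous_on S f" "e > 0"
  obtains d where "d > 0" "\<And>D. D division_of \<Union>D \<Longrightarrow> \<Union>D \<subseteq> S \<Longrightarrow>
      (\<Sum>k\<in>D. Sup k - Inf k) < d \<Longrightarrow> (\<Sum>k\<in>D. \<bar>f (Sup k) - f (Inf k)\<bar>) < e"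
proof -
  from assms obtain d where "d > 0" and d: "\<forall>D. D division_of \<Union>D \<and> \<Union>D \<subseteq> S \<and>
      (\<Sum>k\<in>D. Sup k - Inf k) < d \<longrightarrow> (\<Sum>k\<in>D. \<bar>f (Sup k) - f (Inf k)\<bar>) < e"
    unfolding abs_continuous_on_def by blast
  show ?thesis
    by (rule that[OF \<open>d > 0\<close>]) (use d in blast)
qed

lemma abs_continuous_on_continuous:
  assumes "abs_continuous_on {a..b} h"
  shows "continuous_on {a..b} h"
proof (rule continuous_on_iff[THEN iffD2], intro ballI allI impI)
  fix x e :: real assume x: "x \<in> {a..b}" and e: "0 < e"
  obtain d where d: "d > 0" and D: "\<And>D. D division_of \<Union>D \<Longrightarrow> \<Union>D \<subseteq> {a..b} \<Longrightarrow>
      (\<Sum>k\<in>D. Sup k - Inf k) < d \<Longrightarrow> (\<Sum>k\<in>D. \<bar>h (Sup k) - h (Inf k)\<bar>) < e"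
    by (rule abs_continuous_onE[OF assms e]) blast
  have *: "\<bar>h v - h u\<bar> < e" if "u \<in> {a..b}" "v \<in> {a..b}" "u \<le> v" "v - u < d" for u v
    using D[of "{{u..v}}"] that division_of_self[of u v] by (simp add: cbox_interval)
  have "dist (h y) (h x) < e" if "y \<in> {a..b}" "dist y x < d" for y
    using *[of x y] *[of y x] x that by (cases "x \<le> y") (auto simp: dist_real_def)
  then show "\<exists>d>0. \<forall>x'\<in>{a..b}. dist x' x < d \<longrightarrow> dist (h x') (h x) < e"
    using d by blast
qed

lemma abs_continuous_on_mult_lipschitz:
  assumes h: "abs_continuous_on {a..b} h"
    and lip: "\<And>x y. x \<in> {a..b} \<Longrightarrow> y \<in> {a..b} \<Longrightarrow> \<bar>p x - p y\<bar> \<le> L * \<bar>x - y\<bar>"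
  shows "abs_continuous_on {a..b} (\<lambda>x. h x * p x)"
proof -
  have "continuous_on {a..b} h" by (rule abs_continuous_on_continuous[OF h])
  then have "bounded (h ` {a..b})"
    by (intro compact_imp_bounded compact_continuous_image) auto
  then obtain H where H: "H > 0" "\<And>x. x \<in> {a..b} \<Longrightarrow> \<bar>h x\<bar> \<le> H"
    unfolding bounded_pos by auto
  have "continuous_on {a..b} p"
  proof (rule continuous_on_iff[THEN iffD2], intro ballI allI impI)
    fix x e :: real assume x: "x \<in> {a..b}" and e: "0 < e"
    have "dist (p y) (p x) < e" if "y \<in> {a..b}" "dist y x < e / (\<bar>L\<bar> + 1)" for y
    proof -
      have "\<bar>p y - p x\<bar> \<le> L * \<bar>y - x\<bar>" by (rule lip[OF that(1) x])
      also have "\<dots> \<le> (\<bar>L\<bar> + 1) * \<bar>y - x\<bar>" by (intro mult_right_mono) auto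
      also have "\<dots> < e" using that(2) by (simp add: dist_real_def field_simps add_nonneg_pos)
      finally show ?thesis by (simp add: dist_real_def)
    qed
    then show "\<exists>d>0. \<forall>x'\<in>{a..b}. dist x' x < d \<longrightarrow> dist (p x') (p x) < e"
      using e by (intro exI[of _ "e / (\<bar>L\<bar> + 1)"]) auto
  qed
  then have "bounded (p ` {a..b})"
    by (intro compact_imp_bounded compact_continuous_image) auto
  then obtain C where C: "C > 0" "\<And>x. x \<in> {a..b} \<Longrightarrow> \<bar>p x\<bar> \<le> C"
    unfolding bounded_pos by auto
  define K where "K = \<bar>L\<bar> + 1"
  have K: "K > 0" by (simp add: K_def)
  show ?thesis
    unfolding abs_continuous_on_def
  proof (intro allI impI)
    fix e :: real assume e: "e > 0"
    obtain d where d: "d > 0" and D: "\<And>D. D division_of \<Union>D \<Longrightarrow> \<Union>D \<subseteq> {a..b} \<Longrightarrow>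
        (\<Sum>k\<in>D. Sup k - Inf k) < d \<Longrightarrow> (\<Sum>k\<in>D. \<bar>h (Sup k) - h (Inf k)\<bar>) < e / (2 * C)"
      by (rule abs_continuous_onE[OF h, of "e / (2 * C)"]) (use e C(1) in auto)
    show "\<exists>\<delta>>0. \<forall>D. D division_of \<Union> D \<and> \<Union> D \<subseteq> {a..b} \<and> (\<Sum>k\<in>D. Sup k - Inf k) < \<delta> \<longrightarrow>
        (\<Sum>k\<in>D. \<bar>h (Sup k) * p (Sup k) - h (Inf k) * p (Inf k)\<bar>) < e"
    proof (intro exI[of _ "min d (e / (2 * (H * K)))"] conjI allI impI; (elim conjE)?)
      fix D assume D1: "D division_of \<Union>D" "\<Union>D \<subseteq> {a..b}"
        and D2: "(\<Sum>k\<in>D. Sup k - Inf k) < min d (e / (2 * (H * K)))"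
      have k: "Sup k \<in> {a..b} \<and> Inf k \<in> {a..b} \<and> Inf k \<le> Sup k" if "k \<in> D" for k
      proof -
        obtain u v where "k = cbox u v" using division_ofD(4)[OF D1(1) \<open>k \<in> D\<close>] by blast
        moreover have "k \<noteq> {}" "k \<subseteq> {a..b}"
          using division_ofD(3)[OF D1(1) \<open>k \<in> D\<close>] that D1(2) by auto
        ultimately show ?thesis by auto
      qed
      have "(\<Sum>k\<in>D. \<bar>h (Sup k) * p (Sup k) - h (Inf k) * p (Inf k)\<bar>)
          \<le> (\<Sum>k\<in>D. C * \<bar>h (Sup k) - h (Inf k)\<bar> + H * K * (Sup k - Inf k))"
      proof (rule sum_mono)
        fix k assume "k \<in> D"
        note k = k[OF this]
        have "h (Sup k) * p (Sup k) - h (Inf k) * p (Inf k)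
            = p (Sup k) * (h (Sup k) - h (Inf k)) + h (Inf k) * (p (Sup k) - p (Inf k))"
          by (simp add: algebra_simps)
        also have "\<bar>\<dots>\<bar> \<le> \<bar>p (Sup k)\<bar> * \<bar>h (Sup k) - h (Inf k)\<bar> + \<bar>h (Inf k)\<bar> * \<bar>p (Sup k) - p (Inf k)\<bar>"
          by (metis abs_mult abs_triangle_ineq)
        also have "\<dots> \<le> C * \<bar>h (Sup k) - h (Inf k)\<bar> + H * (K * (Sup k - Inf k))"
        proof (intro add_mono mult_mono)
          have "\<bar>p (Sup k) - p (Inf k)\<bar> \<le> L * \<bar>Sup k - Inf k\<bar>" using k by (intro lip) auto
          also have "\<dots> \<le> K * (Sup k - Inf k)" using k by (auto simp: K_def intro!: mult_mono)
          finally show "\<bar>p (Sup k) - p (Inf k)\<bar> \<le> K * (Sup k - Inf k)" .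
        qed (use C H k in auto)
        finally show "\<bar>h (Sup k) * p (Sup k) - h (Inf k) * p (Inf k)\<bar>
            \<le> C * \<bar>h (Sup k) - h (Inf k)\<bar> + H * K * (Sup k - Inf k)" by (simp add: mult.assoc)
      qed
      also have "\<dots> = C * (\<Sum>k\<in>D. \<bar>h (Sup k) - h (Inf k)\<bar>) + H * K * (\<Sum>k\<in>D. Sup k - Inf k)"
        by (simp add: sum.distrib sum_distrib_left)
      also have "\<dots> < C * (e / (2 * C)) + H * K * (e / (2 * (H * K)))"
        using D[OF D1] D2 C H K by (intro add_strict_mono mult_strict_left_mono) auto
      also have "\<dots> = e" using C H K by simp
      finally show "(\<Sum>k\<in>D. \<bar>h (Sup k) * p (Sup k) - h (Inf k) * p (Inf k)\<bar>) < e" .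
    qed (use d e H K in auto)
  qed
qed

lemma negligible_outer_open:
  fixes E :: "'a::euclidean_space set"
  assumes E: "negligible E" and d: "d > 0"
  obtains T where "open T" "E \<subseteq> T" "T \<in> lmeasurable" "measure lebesgue T < d"
proof -
  obtain T where T: "open T" "E \<subseteq> T" "T - E \<in> lmeasurable" "emeasure lebesgue (T - E) < ennreal d"
    using sets_lebesgue_outer_open[OF negligible_imp_sets[OF E] d] .
  have E': "E \<in> lmeasurable" "measure lebesgue E = 0"
    using E negligible_iff_measure by auto
  have eq: "T = (T - E) \<union> E" using T(2) by blast
  have "T \<in> lmeasurable" using fmeasurable.Un[OF T(3) E'(1)] eq by simp
  moreover have "measure lebesgue T \<le> measure lebesgue (T - E) + measure lebesgue E"
    using measure_Un_le[of "T - E" lebesgue E] T(3) E'(1) eq by (simp add: fmeasurableD)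
  moreover have "measure lebesgue (T - E) < d"
    using T(3,4) d by (simp add: emeasure_eq_measure2 ennreal_less_iff)
  ultimately show ?thesis using that T E' by auto
qed

text \<open>The fundamental theorem of calculus for an almost everywhere derivative, proved with gauges. At the
points where the derivative exists the gauge makes the increments of \<open>h\<close> agree with \<open>h'\<close> up to a
small multiple of the length. The intervals tagged in the exceptional set are forced into an open set
of small measure, where absolute continuity makes the sum of the increments small; there the
integrand is replaced by 0.\<close>

lemma abs_continuous_on_has_integral:
  fixes h h' :: "real \<Rightarrow> real"
  assumes ab: "a \<le> b" and h: "abs_continuous_on {a..b} h" and E: "negligible E"
    and deriv: "\<And>x. x \<in> {a..b} - E \<Longrightarrow> (h has_vector_derivative h' x) (at x within {a..b})"
  shows "(h' has_integral (h b - h a)) {a..b}"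
proof -
  define g where "g x = (if x \<in> E then 0 else h' x)" for x
  have "(g has_integral (h b - h a)) {a..b}"
    unfolding has_integral_factor_content_real
  proof (intro allI impI)
    fix e :: real assume e: "e > 0"
    \<comment> \<open>the error budget \<open>e (b - a)\<close> is shared between the two kinds of tags\<close>
    define e1 where "e1 = e * (b - a) / 2"
    show "\<exists>\<gamma>. gauge \<gamma> \<and> (\<forall>p. p tagged_division_of {a..b} \<and> \<gamma> fine p \<longrightarrow>
        norm ((\<Sum>(x, k)\<in>p. measure lborel k *\<^sub>R g x) - (h b - h a)) \<le> e * measure lborel {a..b})"
    proof (cases "a = b")
      case True
      show ?thesis
      proof (intro exI[of _ "\<lambda>x. ball x 1"] conjI allI impI; (elim conjE)?)
        fix p assume p: "p tagged_division_of {a..b}"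
        have "measure lborel k = 0" if xk: "(x, k) \<in> p" for x k
        proof -
          obtain u v where uv: "k = cbox u v" using tagged_division_ofD(4)[OF p xk] by blast
          have "k \<subseteq> {a..b}" using tagged_division_ofD(3)[OF p xk] .
          then have "u \<in> {b} \<and> v \<in> {b}" if "u \<le> v"
            unfolding uv using True that by (metis atLeastAtMost_iff atLeastAtMost_singleton box_real(2) order_refl subsetD)
          then show ?thesis unfolding uv by (cases "u \<le> v") auto
        qed
        then have "(\<Sum>(x, k)\<in>p. measure lborel k *\<^sub>R g x) = 0" by (intro sum.neutral) auto
        then show "norm ((\<Sum>(x, k)\<in>p. measure lborel k *\<^sub>R g x) - (h b - h a)) \<le> e * measure lborel {a..b}"
          using True by simp
      qed auto
    next
      case False
      with ab have ab': "a < b" by simp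
      have e1: "e1 > 0" using e ab' by (simp add: e1_def)
      obtain \<delta> where \<delta>: "\<delta> > 0" and D: "\<And>D. D division_of \<Union>D \<Longrightarrow> \<Union>D \<subseteq> {a..b} \<Longrightarrow>
        (\<Sum>k\<in>D. Sup k - Inf k) < \<delta> \<Longrightarrow> (\<Sum>k\<in>D. \<bar>h (Sup k) - h (Inf k)\<bar>) < e1"
        by (rule abs_continuous_onE[OF h e1]) blast
      obtain T where T: "open T" "E \<subseteq> T" "T \<in> lmeasurable" "measure lebesgue T < \<delta>"
        by (rule negligible_outer_open[OF E \<delta>])
      have "\<exists>d>0. (x \<in> E \<longrightarrow> ball x d \<subseteq> T) \<and>
          (x \<in> {a..b} - E \<longrightarrow> (\<forall>y\<in>{a..b}. \<bar>y - x\<bar> < d \<longrightarrow> \<bar>h y - h x - (y - x) * h' x\<bar> \<le> e / 2 * \<bar>y - x\<bar>))"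
        for x
      proof (cases "x \<in> E")
        case True
        then obtain d where "d > 0" "ball x d \<subseteq> T"
          using T(1,2) open_contains_ball by blast
        with True show ?thesis by auto
      next
        case False
        show ?thesis
        proof (cases "x \<in> {a..b}")
          case True
          have "(h has_derivative (\<lambda>t. t *\<^sub>R h' x)) (at x within {a..b})"
            using deriv[of x] True False by (simp add: has_vector_derivative_def)
          then obtain d where "d > 0" "\<forall>y\<in>{a..b}. norm (y - x) < d \<longrightarrow>
              norm (h y - h x - (y - x) *\<^sub>R h' x) \<le> e / 2 * norm (y - x)"
            unfolding has_derivative_within_alt using e by (metis half_gt_zero)
          then show ?thesis using False by auto
        qed (use False in \<open>auto intro: exI[of _ 1]\<close>)
      qed
      then obtain d where d: "\<And>x. d x > 0"
        and dE: "\<And>x. x \<in> E \<Longrightarrow> ball x (d x) \<subseteq> T"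
        and dN: "\<And>x y. x \<in> {a..b} - E \<Longrightarrow> y \<in> {a..b} \<Longrightarrow> \<bar>y - x\<bar> < d x \<Longrightarrow>
            \<bar>h y - h x - (y - x) * h' x\<bar> \<le> e / 2 * \<bar>y - x\<bar>"
        by metis
      show ?thesis
      proof (intro exI[of _ "\<lambda>x. ball x (d x)"] conjI allI impI; (elim conjE)?)
        show "gauge (\<lambda>x. ball x (d x))" using d by (intro gauge_ball_dependent) auto
      next
        fix p assume p: "p tagged_division_of {a..b}" and fine: "(\<lambda>x. ball x (d x)) fine p"
        note ptd = tagged_division_ofD[OF p]
        have kk: "\<exists>u v. k = {u..v} \<and> u \<le> v \<and> x \<in> {u..v} \<and> {u..v} \<subseteq> {a..b} \<and> {u..v} \<subseteq> ball x (d x)"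
          if xk: "(x, k) \<in> p" for x k
        proof -
          obtain u v where "k = cbox u v" using ptd(4)[OF xk] by blast
          moreover have "x \<in> k" "k \<subseteq> {a..b}" "k \<subseteq> ball x (d x)"
            using ptd(2,3)[OF that] fine that by (auto dest: fineD)
          ultimately show ?thesis by (intro exI[of _ u] exI[of _ v]) auto
        qed
        define pE where "pE = {(x, k). (x, k) \<in> p \<and> x \<in> E}"
        define pN where "pN = {(x, k). (x, k) \<in> p \<and> x \<notin> E}"
        have fin: "finite p" "finite pE" "finite pN" 
          using ptd(1) by (auto simp: pE_def pN_def intro: rev_finite_subset)
        have p_eq: "p = pE \<union> pN" "pE \<inter> pN = {}" by (auto simp: pE_def pN_def)
        have tele: "(\<Sum>(x, k)\<in>p. h (Sup k) - h (Inf k)) = h b - h a"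
          using additive_tagged_division_1[OF ab p] by simp
        have cont: "(\<Sum>(x, k)\<in>p. measure lborel k) = b - a"
          using additive_content_tagged_division[of p a b] p ab by (simp add: cbox_interval)
        \<comment> \<open>the intervals tagged in \<open>E\<close> lie in \<open>T\<close>, so their total length is below \<open>\<delta>\<close>\<close>
        have "(\<Sum>(x, k)\<in>pE. \<bar>h (Sup k) - h (Inf k)\<bar>) \<le> e1"
        proof -
          have tp: "pE tagged_partial_division_of {a..b}"
            using tagged_partial_division_subset[of p "{a..b}" pE] p
            by (auto simp: tagged_division_of_def pE_def)
          have div: "snd ` pE division_of \<Union>(snd ` pE)"
            using tagged_partial_division_of_Union_self[OF tp] division_of_tagged_division by blast
          have sub: "\<Union>(snd ` pE) \<subseteq> {a..b} \<inter> T"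
          proof -
            have "k \<subseteq> {a..b} \<inter> T" if "(x, k) \<in> pE" for x k
              using kk[of x k] dE[of x] that by (auto simp: pE_def)
            then show ?thesis by fastforce
          qed
          have "(\<Sum>k\<in>snd ` pE. Sup k - Inf k) = (\<Sum>k\<in>snd ` pE. measure lebesgue k)"
          proof (rule sum.cong)
            fix k assume "k \<in> snd ` pE"
            then obtain x where "(x, k) \<in> p" by (auto simp: pE_def)
            from kk[OF this] show "Sup k - Inf k = measure lebesgue k" by auto
          qed simp
          also have "\<dots> = measure lebesgue (\<Union>(snd ` pE))"
            using content_division[OF div] by simp
          also have "\<dots> \<le> measure lebesgue T"
            using sub T by (intro measure_mono_fmeasurable) (auto intro: lmeasurable_division[OF div, THEN fmeasurableD])
          also have "\<dots> < \<delta>" by fact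
          finally have "(\<Sum>k\<in>snd ` pE. \<bar>h (Sup k) - h (Inf k)\<bar>) < e1"
            using div sub by (intro D) auto
          moreover have "(\<Sum>(x, k)\<in>pE. \<bar>h (Sup k) - h (Inf k)\<bar>) = (\<Sum>k\<in>snd ` pE. \<bar>h (Sup k) - h (Inf k)\<bar>)"
          proof -
            define F where "F k = (if k = {} then 0 else \<bar>h (Sup k) - h (Inf k)\<bar>)" for k
            have F: "\<bar>h (Sup k) - h (Inf k)\<bar> = F k" if "(x, k) \<in> pE" for x k
              using kk[of x k] that by (auto simp: pE_def F_def)
            have "(\<Sum>(x, k)\<in>pE. F k) = (\<Sum>k\<in>snd ` pE. F k)"
              by (rule sum.over_tagged_division_lemma[OF tagged_partial_division_of_Union_self[OF tp]])
                (auto simp: F_def)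
            moreover have "(\<Sum>(x, k)\<in>pE. \<bar>h (Sup k) - h (Inf k)\<bar>) = (\<Sum>(x, k)\<in>pE. F k)"
              by (intro sum.cong) (auto simp: F)
            moreover have "(\<Sum>k\<in>snd ` pE. \<bar>h (Sup k) - h (Inf k)\<bar>) = (\<Sum>k\<in>snd ` pE. F k)"
              by (intro sum.cong) (auto simp: F)
            ultimately show ?thesis by simp
          qed
          ultimately show ?thesis by simp
        qed
        moreover have "(\<Sum>(x, k)\<in>pN. \<bar>measure lborel k * h' x - (h (Sup k) - h (Inf k))\<bar>) \<le> e1"
        proof -
          have "(\<Sum>(x, k)\<in>pN. \<bar>measure lborel k * h' x - (h (Sup k) - h (Inf k))\<bar>) \<le> (\<Sum>(x, k)\<in>pN. e / 2 * measure lborel k)"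
          proof (rule sum_mono, clarify)
            fix x k assume xk: "(x, k) \<in> pN"
            then have "(x, k) \<in> p" "x \<notin> E" by (auto simp: pN_def)
            from kk[OF this(1)] obtain u v where uv: "k = {u..v}" "u \<le> v" "x \<in> {u..v}" "{u..v} \<subseteq> {a..b}" "{u..v} \<subseteq> ball x (d x)" by blast
            have x: "x \<in> {a..b} - E" using uv \<open>x \<notin> E\<close> by auto
            have uvd: "u \<in> {a..b}" "v \<in> {a..b}" "\<bar>u - x\<bar> < d x" "\<bar>v - x\<bar> < d x"
              using uv(2,4) subsetD[OF uv(5), of u] subsetD[OF uv(5), of v]
              by (auto simp: dist_real_def abs_minus_commute)
            have "\<bar>h u - h x - (u - x) * h' x\<bar> \<le> e / 2 * \<bar>u - x\<bar>" "\<bar>h v - h x - (v - x) * h' x\<bar> \<le> e / 2 * \<bar>v - x\<bar>"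
              using dN[OF x] uvd by auto
            moreover have "e / 2 * \<bar>u - x\<bar> + e / 2 * \<bar>v - x\<bar> = e / 2 * (v - u)"
            proof -
              have "\<bar>u - x\<bar> + \<bar>v - x\<bar> = v - u" using uv(3) by auto
              then show ?thesis by (metis distrib_left)
            qed
            moreover have "(v - u) * h' x - (h v - h u)
              = (h u - h x - (u - x) * h' x) - (h v - h x - (v - x) * h' x)"
              by (simp add: algebra_simps)
            ultimately have "\<bar>(v - u) * h' x - (h v - h u)\<bar> \<le> e / 2 * (v - u)" by linarith
            then show "\<bar>measure lborel k * h' x - (h (Sup k) - h (Inf k))\<bar> \<le> e / 2 * measure lborel k"
              using uv by simp
          qed
          also have "\<dots> = e / 2 * (\<Sum>(x, k)\<in>pN. measure lborel k)"
            by (simp add: sum_distrib_left case_prod_unfold)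
          also have "(\<Sum>(x, k)\<in>pN. measure lborel k) \<le> (\<Sum>(x, k)\<in>p. measure lborel k)"
            using fin p_eq by (intro sum_mono2) auto
          also have "e / 2 * \<dots> = e1" by (simp add: cont e1_def)
          finally show ?thesis using e by simp
        qed
        moreover have "(\<Sum>(x, k)\<in>p. measure lborel k *\<^sub>R g x) - (h b - h a)
            = (\<Sum>(x, k)\<in>pN. measure lborel k * h' x - (h (Sup k) - h (Inf k))) - (\<Sum>(x, k)\<in>pE. h (Sup k) - h (Inf k))"
        proof -
          have "(\<Sum>(x, k)\<in>p. measure lborel k *\<^sub>R g x) - (h b - h a)
            = (\<Sum>(x, k)\<in>p. measure lborel k * g x - (h (Sup k) - h (Inf k)))"
            unfolding tele[symmetric] by (simp add: sum_subtractf case_prod_unfold)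
          also have "\<dots> = (\<Sum>(x, k)\<in>pE. measure lborel k * g x - (h (Sup k) - h (Inf k)))
              + (\<Sum>(x, k)\<in>pN. measure lborel k * g x - (h (Sup k) - h (Inf k)))"
            unfolding p_eq(1) using fin p_eq by (intro sum.union_disjoint) auto
          also have "(\<Sum>(x, k)\<in>pE. measure lborel k * g x - (h (Sup k) - h (Inf k)))
             = - (\<Sum>(x, k)\<in>pE. h (Sup k) - h (Inf k))"
            unfolding sum_negf[symmetric] by (rule sum.cong) (auto simp: pE_def g_def)
          also have "(\<Sum>(x, k)\<in>pN. measure lborel k * g x - (h (Sup k) - h (Inf k)))
             = (\<Sum>(x, k)\<in>pN. measure lborel k * h' x - (h (Sup k) - h (Inf k)))"
            by (rule sum.cong) (auto simp: pN_def g_def)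
          finally show ?thesis by simp
        qed
        moreover have "\<bar>\<Sum>(x, k)\<in>pN. measure lborel k * h' x - (h (Sup k) - h (Inf k))\<bar>
            \<le> (\<Sum>(x, k)\<in>pN. \<bar>measure lborel k * h' x - (h (Sup k) - h (Inf k))\<bar>)"
          using sum_abs[of "\<lambda>(x, k). measure lborel k * h' x - (h (Sup k) - h (Inf k))" pN]
          by (simp add: case_prod_unfold)
        moreover have "\<bar>\<Sum>(x, k)\<in>pE. h (Sup k) - h (Inf k)\<bar>
            \<le> (\<Sum>(x, k)\<in>pE. \<bar>h (Sup k) - h (Inf k)\<bar>)"
          using sum_abs[of "\<lambda>(x, k). h (Sup k) - h (Inf k)" pE]
          by (simp add: case_prod_unfold)
        ultimately have "\<bar>(\<Sum>(x, k)\<in>p. measure lborel k *\<^sub>R g x) - (h b - h a)\<bar> \<le> e1 + e1"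
          by linarith
        then show "norm ((\<Sum>(x, k)\<in>p. measure lborel k *\<^sub>R g x) - (h b - h a)) \<le> e * measure lborel {a..b}"
          using ab by (simp add: e1_def)
      qed
    qed
  qed
  then show ?thesis
    by (rule has_integral_spike[OF E, rotated]) (auto simp: g_def)
qed

lemma poly_lipschitz_on_interval:
  fixes q :: "real poly"
  obtains L where "L \<ge> 0" "\<And>x y. x \<in> {a..b} \<Longrightarrow> y \<in> {a..b} \<Longrightarrow> \<bar>poly q x - poly q y\<bar> \<le> L * \<bar>x - y\<bar>"
proof -
  have "bounded (poly (pderiv q) ` {a..b})"
    by (intro compact_imp_bounded compact_continuous_image) (auto intro!: continuous_intros)
  then obtain L where L: "L > 0" "\<And>x. x \<in> {a..b} \<Longrightarrow> \<bar>poly (pderiv q) x\<bar> \<le> L"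
    unfolding bounded_pos by auto
  have "norm (poly q x - poly q y) \<le> L * norm (x - y)" if "x \<in> {a..b}" "y \<in> {a..b}" for x y
    by (rule field_differentiable_bound[of "{a..b}" "poly q" "poly (pderiv q)"])
      (use L that in \<open>auto intro: DERIV_subset[OF poly_DERIV]\<close>)
  with L(1) show ?thesis by (intro that[of L]) auto
qed

text \<open>A product of an absolutely continuous function and a polynomial is again absolutely continuous, so
the fundamental theorem applies to it directly.\<close>

lemma integral_by_parts_abs_continuous_poly:
  fixes h h' :: "real \<Rightarrow> real" and q :: "real poly"
  assumes ab: "a \<le> b" and h: "abs_continuous_on {a..b} h" and E: "negligible E"
    and deriv: "\<And>x. x \<in> {a..b} - E \<Longrightarrow> (h has_vector_derivative h' x) (at x within {a..b})"
  shows "integral {a..b} (\<lambda>x. h x * poly (pderiv q) x)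
      = h b * poly q b - h a * poly q a - integral {a..b} (\<lambda>x. h' x * poly q x)"
proof -
  obtain L where L: "\<And>x y. x \<in> {a..b} \<Longrightarrow> y \<in> {a..b} \<Longrightarrow> \<bar>poly q x - poly q y\<bar> \<le> L * \<bar>x - y\<bar>"
    using poly_lipschitz_on_interval[of a b q] by blast
  have "((\<lambda>x. h x * poly (pderiv q) x + h' x * poly q x) has_integral
      (h b * poly q b - h a * poly q a)) {a..b}"
  proof (rule abs_continuous_on_has_integral[OF ab abs_continuous_on_mult_lipschitz[OF h L] E])
    fix x assume x: "x \<in> {a..b} - E"
    show "((\<lambda>x. h x * poly q x) has_vector_derivative h x * poly (pderiv q) x + h' x * poly q x)
        (at x within {a..b})"
      using deriv[OF x] poly_DERIV[of q x]
      by (auto simp flip: has_real_derivative_iff_has_vector_derivative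
          intro!: derivative_eq_intros intro: DERIV_subset)
  qed
  moreover have "(\<lambda>x. h x * poly (pderiv q) x) integrable_on {a..b}"
    using abs_continuous_on_continuous[OF h]
    by (intro integrable_continuous_real continuous_intros)
  then have "((\<lambda>x. h x * poly (pderiv q) x) has_integral
      integral {a..b} (\<lambda>x. h x * poly (pderiv q) x)) {a..b}"
    by (rule integrable_integral)
  ultimately have "((\<lambda>x. (h x * poly (pderiv q) x + h' x * poly q x) - h x * poly (pderiv q) x) has_integral
      (h b * poly q b - h a * poly q a) - integral {a..b} (\<lambda>x. h x * poly (pderiv q) x)) {a..b}"
    by (rule has_integral_diff)
  then show ?thesis by (simp add: integral_unique)
qed

section \<open>Smooth cutoff functions\<close>

text \<open>The functions \<open>p (1/x) exp (-1/x)\<close>, extended by 0. Admitting an arbitrary polynomial makes the family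
closed under differentiation, which proves smoothness at once.\<close>

definition exp_inv :: "real poly \<Rightarrow> real \<Rightarrow> real" where
  "exp_inv p x = (if x > 0 then poly p (1 / x) * exp (- (1 / x)) else 0)"

lemma poly_mult_exp_neg_tendsto_0: "((\<lambda>y. poly p y * exp (- y)) \<longlongrightarrow> (0 :: real)) at_top"
proof -
  have "((\<lambda>y. \<Sum>i\<le>degree p. coeff p i * (y ^ i / exp y)) \<longlongrightarrow> (0::real)) at_top"
    by (intro tendsto_null_sum tendsto_mult_right_zero tendsto_power_div_exp_0)
  then show ?thesis
    by (simp add: poly_altdef sum_distrib_right exp_minus divide_inverse mult.assoc)
qed

lemma DERIV_exp_inv:
  "(exp_inv p has_real_derivative exp_inv (pCons 0 (pCons 0 (p - pderiv p))) x) (at x)"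
proof -
  consider "x > 0" | "x < 0" | "x = 0" by linarith
  then show ?thesis
  proof cases
    case 1
    have "((\<lambda>x. poly p (1 / x) * exp (- (1 / x))) has_real_derivative
        exp_inv (pCons 0 (pCons 0 (p - pderiv p))) x) (at x)"
      using 1 unfolding exp_inv_def
      by (auto intro!: derivative_eq_intros simp: field_simps power2_eq_square)
    then show ?thesis
      by (rule has_field_derivative_transform_within_open[of _ _ _ "{0<..}"])
        (use 1 in \<open>auto simp: exp_inv_def\<close>)
  next
    case 2
    have "((\<lambda>x. 0) has_real_derivative exp_inv (pCons 0 (pCons 0 (p - pderiv p))) x) (at x)"
      using 2 unfolding exp_inv_def by auto
    then show ?thesis
      by (rule has_field_derivative_transform_within_open[of _ _ _ "{..<0}"])
        (use 2 in \<open>auto simp: exp_inv_def\<close>)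
  next
    case 3
    have "((\<lambda>h. exp_inv p h / h) \<longlongrightarrow> 0) (at_left 0)"
      by (rule tendsto_eventually) (auto simp: exp_inv_def eventually_at_left_field intro: exI[of _ "-1"])
    moreover have "((\<lambda>h. exp_inv p h / h) \<longlongrightarrow> 0) (at_right 0)"
    proof -
      have "((\<lambda>h. poly (pCons 0 p) (inverse h) * exp (- inverse h)) \<longlongrightarrow> 0) (at_right (0::real))"
        by (rule filterlim_compose[OF poly_mult_exp_neg_tendsto_0 filterlim_inverse_at_top_right])
      then show ?thesis
        by (rule Lim_transform_eventually)
          (auto simp: exp_inv_def eventually_at_right_field divide_inverse intro: exI[of _ 1])
    qed
    ultimately have "((\<lambda>h. exp_inv p h / h) \<longlongrightarrow> 0) (at 0)"
      by (simp add: filterlim_at_split)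
    then show ?thesis
      using 3 by (simp add: DERIV_def exp_inv_def)
  qed
qed

text \<open>An inductively generated set of functions that contains the derivative of each of its members.
Smoothness of a composite function then needs no calculation with higher derivatives: it is enough
to see how the function is built.\<close>

inductive smooth_closure :: "(real \<Rightarrow> real) \<Rightarrow> bool" where
  exp_inv: "smooth_closure (exp_inv p)"
| poly: "smooth_closure (poly p)"
| affine: "smooth_closure f \<Longrightarrow> smooth_closure (\<lambda>x. f (a * x + b))"
| add: "smooth_closure f \<Longrightarrow> smooth_closure g \<Longrightarrow> smooth_closure (\<lambda>x. f x + g x)"
| mult: "smooth_closure f \<Longrightarrow> smooth_closure g \<Longrightarrow> smooth_closure (\<lambda>x. f x * g x)"
| inverse: "smooth_closure f \<Longrightarrow> (\<And>x. f x \<noteq> 0) \<Longrightarrow> smooth_closure (\<lambda>x. inverse (f x))"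

lemma smooth_closure_const: "smooth_closure (\<lambda>x. c)"
proof -
  have "poly [:c:] = (\<lambda>x. c)" by (auto simp: fun_eq_iff)
  then show ?thesis using smooth_closure.poly[of "[:c:]"] by simp
qed

lemma smooth_closure_DERIV:
  assumes "smooth_closure f"
  shows "\<exists>f'. smooth_closure f' \<and> (\<forall>x. (f has_real_derivative f' x) (at x))"
  using assms
proof induction
  case (exp_inv p)
  show ?case using DERIV_exp_inv smooth_closure.exp_inv by blast
next
  case (poly p)
  show ?case using poly_DERIV smooth_closure.poly by blast
next
  case (affine f a b)
  then obtain f' where f': "smooth_closure f'" "\<And>x. (f has_real_derivative f' x) (at x)" by blast
  have "((\<lambda>x. f (a * x + b)) has_real_derivative a * f' (a * x + b)) (at x)" for x
    by (rule DERIV_cong[OF DERIV_chain2[OF f'(2)]]) (auto intro!: derivative_eq_intros)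
  moreover have "smooth_closure (\<lambda>x. a * f' (a * x + b))"
    by (intro smooth_closure.mult smooth_closure_const smooth_closure.affine f')
  ultimately show ?case by blast
next
  case (add f g)
  then obtain f' g' where "smooth_closure f'" "\<And>x. (f has_real_derivative f' x) (at x)"
    "smooth_closure g'" "\<And>x. (g has_real_derivative g' x) (at x)" by blast
  then show ?case
    by (intro exI[of _ "\<lambda>x. f' x + g' x"]) (auto intro: smooth_closure.add DERIV_add)
next
  case (mult f g)
  then obtain f' g' where "smooth_closure f'" "\<And>x. (f has_real_derivative f' x) (at x)"
    "smooth_closure g'" "\<And>x. (g has_real_derivative g' x) (at x)" by blast
  with mult show ?case
    by (intro exI[of _ "\<lambda>x. f' x * g x + g' x * f x"])
      (auto intro!: smooth_closure.add smooth_closure.mult DERIV_mult)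
next
  case (inverse f)
  then obtain f' where f': "smooth_closure f'" "\<And>x. (f has_real_derivative f' x) (at x)" by blast
  have "((\<lambda>x. inverse (f x)) has_real_derivative - 1 * (inverse (f x) * f' x * inverse (f x))) (at x)" for x
    using DERIV_inverse'[OF f'(2) inverse(2)] by simp
  moreover have "smooth_closure (\<lambda>x. - 1 * (inverse (f x) * f' x * inverse (f x)))"
    using inverse f' by (intro smooth_closure.mult smooth_closure_const smooth_closure.inverse)
  ultimately show ?case by blast
qed

lemma smooth_closure_deriv:
  assumes "smooth_closure f"
  shows "smooth_closure (deriv f)" "(f has_real_derivative deriv f x) (at x)"
proof -
  obtain f' where f': "smooth_closure f'" "\<And>x. (f has_real_derivative f' x) (at x)"
    using smooth_closure_DERIV[OF assms] by blast
  have "deriv f = f'" using f'(2) DERIV_imp_deriv by blast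
  with f' show "smooth_closure (deriv f)" "(f has_real_derivative deriv f x) (at x)" by auto
qed

lemma smooth_closure_higher_deriv: "smooth_closure f \<Longrightarrow> smooth_closure ((deriv ^^ k) f)"
  by (induction k) (auto intro: smooth_closure_deriv)

lemma smooth_closure_differentiable: "smooth_closure f \<Longrightarrow> f differentiable_on UNIV"
  using smooth_closure_deriv(2) real_differentiable_def
  by (auto simp: differentiable_on_def)

lemma smooth_closure_continuous: "smooth_closure f \<Longrightarrow> continuous_on A f"
  using smooth_closure_deriv(2) DERIV_isCont by (blast intro: continuous_at_imp_continuous_on)

definition smooth_step :: "real \<Rightarrow> real" where
  "smooth_step x = exp_inv 1 x * inverse (exp_inv 1 x + exp_inv 1 (- 1 * x + 1))"

lemma exp_inv_1: "exp_inv 1 x \<ge> 0" "exp_inv 1 x > 0 \<longleftrightarrow> x > 0" "exp_inv 1 x = 0 \<longleftrightarrow> x \<le> 0"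
  by (auto simp: exp_inv_def)

lemma smooth_step_denominator: "exp_inv 1 x + exp_inv 1 (- 1 * x + 1) > 0"
  using exp_inv_1(1)[of x] exp_inv_1(1)[of "- 1 * x + 1"] exp_inv_1(2)[of x] exp_inv_1(2)[of "- 1 * x + 1"]
  by linarith

lemma smooth_step_smooth: "smooth_closure smooth_step"
  unfolding smooth_step_def using smooth_step_denominator
  by (intro smooth_closure.mult smooth_closure.inverse smooth_closure.add
      smooth_closure.affine smooth_closure.exp_inv) (metis less_irrefl)

lemma smooth_step_range: "0 \<le> smooth_step x" "smooth_step x \<le> 1"
  using smooth_step_denominator[of x] exp_inv_1(1)[of x] exp_inv_1(1)[of "- 1 * x + 1"]
  by (auto simp: smooth_step_def field_simps)

lemma smooth_step_0: "x \<le> 0 \<Longrightarrow> smooth_step x = 0"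
  by (simp add: smooth_step_def exp_inv_def)

lemma smooth_step_1: "x \<ge> 1 \<Longrightarrow> smooth_step x = 1"
  by (simp add: smooth_step_def exp_inv_def)

lemma smooth_step_deriv_0: "x < 0 \<or> x > 1 \<Longrightarrow> deriv smooth_step x = 0"
proof -
  assume x: "x < 0 \<or> x > 1"
  have "(smooth_step has_real_derivative 0) (at x)"
  proof (cases "x < 0")
    case True
    show ?thesis
      by (rule has_field_derivative_transform_within_open[OF DERIV_const[of 0], of "{..<0}"])
        (use True smooth_step_0 in auto)
  next
    case False
    show ?thesis
      by (rule has_field_derivative_transform_within_open[OF DERIV_const[of 1], of "{1<..}"])
        (use False x smooth_step_1 in auto)
  qed
  then show ?thesis by (rule DERIV_imp_deriv)
qed

text \<open>The weight \<open>x + 1\<close> is the distance to the end point after the rescaling in \<open>cutoff\<close>; the bound holds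
because the derivative is supported in \<open>[0,1]\<close>.\<close>

lemma smooth_step_deriv_bounded:
  obtains C where "C \<ge> 0" "\<And>x. x \<ge> -1 \<Longrightarrow> (x + 1) * \<bar>deriv smooth_step x\<bar> \<le> C"
proof -
  have "bounded (deriv smooth_step ` {0..1})"
    by (intro compact_imp_bounded compact_continuous_image smooth_closure_continuous
        smooth_closure_deriv smooth_step_smooth) auto
  then obtain C where C: "C > 0" "\<And>x. x \<in> {0..1} \<Longrightarrow> \<bar>deriv smooth_step x\<bar> \<le> C"
    unfolding bounded_pos by auto
  have "(x + 1) * \<bar>deriv smooth_step x\<bar> \<le> 2 * C" if "x \<ge> -1" for x
  proof (cases "x \<in> {0..1}")
    case True
    then show ?thesis using C by (intro mult_mono) auto
  next
    case False
    then have "deriv smooth_step x = 0" by (intro smooth_step_deriv_0) auto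
    then show ?thesis using C by simp
  qed
  then show ?thesis using C(1) by (intro that[of "2 * C"]) auto
qed

text \<open>Equal to 1 up to distance \<open>2 / (n + 1)\<close> from the end points of \<open>[-1,1]\<close> and to 0 within distance
\<open>1 / (n + 1)\<close> of them.\<close>

definition cutoff :: "nat \<Rightarrow> real \<Rightarrow> real" where
  "cutoff n x = smooth_step (real (Suc n) * x + real n) * smooth_step (- real (Suc n) * x + real n)"

lemma cutoff_smooth: "smooth_closure (cutoff n)"
  unfolding cutoff_def by (intro smooth_closure.mult smooth_closure.affine smooth_step_smooth)

lemma cutoff_range: "0 \<le> cutoff n x" "cutoff n x \<le> 1"
  unfolding cutoff_def using smooth_step_range by (auto intro: mult_nonneg_nonneg mult_le_one)

lemma deriv_cutoff:
  "deriv (cutoff n) x =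
    real (Suc n) * deriv smooth_step (real (Suc n) * x + real n) * smooth_step (- real (Suc n) * x + real n)
    - real (Suc n) * deriv smooth_step (- real (Suc n) * x + real n) * smooth_step (real (Suc n) * x + real n)"
proof -
  have d: "((\<lambda>x. smooth_step (a * x + b)) has_real_derivative deriv smooth_step (a * x + b) * a) (at x)" for a b
    by (rule DERIV_chain2[OF smooth_closure_deriv(2)[OF smooth_step_smooth]])
      (auto intro!: derivative_eq_intros)
  show ?thesis
    unfolding cutoff_def
    by (rule DERIV_imp_deriv) (rule DERIV_cong[OF DERIV_mult[OF d d]], simp add: algebra_simps)
qed

lemma test_function_poly_cutoff: "test_function (\<lambda>x. poly q x * cutoff n x)"
proof -
  let ?f = "\<lambda>x. poly q x * cutoff n x"
  let ?I = "{-1 + 1 / real (Suc n)..1 - 1 / real (Suc n)}"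
  have "{x. ?f x \<noteq> 0} \<subseteq> ?I"
  proof
    fix x assume "x \<in> {x. ?f x \<noteq> 0}"
    then have "smooth_step (real (Suc n) * x + real n) \<noteq> 0" "smooth_step (- real (Suc n) * x + real n) \<noteq> 0"
      by (auto simp: cutoff_def)
    then have "real (Suc n) * x + real n > 0" "- real (Suc n) * x + real n > 0"
      using smooth_step_0 not_less by blast+
    then show "x \<in> ?I" by (auto simp: field_simps)
  qed
  then have sub: "closure {x. ?f x \<noteq> 0} \<subseteq> ?I" by (intro closure_minimal) auto
  have "smooth_closure ?f"
    by (intro smooth_closure.mult smooth_closure.poly cutoff_smooth)
  then have "(deriv ^^ k) ?f differentiable_on UNIV" for k
    by (intro smooth_closure_differentiable smooth_closure_higher_deriv)
  moreover have "compact (closure {x. ?f x \<noteq> 0})"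
    using sub by (meson bounded_closed_interval bounded_subset closed_closure compact_eq_bounded_closed)
  moreover have "?I \<subseteq> {-1<..<1}"
  proof -
    have "1 / real (Suc n) > 0" by simp
    then show ?thesis unfolding subset_iff atLeastAtMost_iff greaterThanLessThan_iff by linarith
  qed
  ultimately show ?thesis unfolding test_function_def using sub by auto
qed

text \<open>The derivative of the cutoff grows like \<open>n\<close>, but only at distance of order \<open>1 / n\<close> from the end points,
where a polynomial that vanishes at \<open>\<plusminus>1\<close> is itself of order \<open>1 / n\<close>. So the derivatives of the
products stay bounded, as dominated convergence requires.\<close>

lemma poly_cutoff_deriv_bounded:
  assumes q: "poly q 1 = 0" "poly q (-1) = 0"
  obtains B where "\<And>n x. x \<in> {-1<..<1} \<Longrightarrow> \<bar>deriv (\<lambda>x. poly q x * cutoff n x) x\<bar> \<le> B"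
    "\<And>x. x \<in> {-1<..<1} \<Longrightarrow> (\<lambda>n. deriv (\<lambda>x. poly q x * cutoff n x) x) \<longlonglongrightarrow> poly (pderiv q) x"
    "\<And>x. x \<in> {-1<..<1} \<Longrightarrow> (\<lambda>n. poly q x * cutoff n x) \<longlonglongrightarrow> poly q x"
proof -
  obtain L where L: "L \<ge> 0" "\<And>x y. x \<in> {-1..1} \<Longrightarrow> y \<in> {-1..1} \<Longrightarrow> \<bar>poly q x - poly q y\<bar> \<le> L * \<bar>x - y\<bar>"
    using poly_lipschitz_on_interval by blast
  obtain C where C: "C \<ge> 0" "\<And>x. x \<ge> -1 \<Longrightarrow> (x + 1) * \<bar>deriv smooth_step x\<bar> \<le> C"
    using smooth_step_deriv_bounded by blast
  have "bounded (poly (pderiv q) ` {-1..1})"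
    by (intro compact_imp_bounded compact_continuous_image) (auto intro!: continuous_intros)
  then obtain D where D: "D > 0" "\<And>x. x \<in> {-1..1} \<Longrightarrow> \<bar>poly (pderiv q) x\<bar> \<le> D"
    unfolding bounded_pos by auto
  have dv: "deriv (\<lambda>x. poly q x * cutoff n x) x = poly (pderiv q) x * cutoff n x + deriv (cutoff n) x * poly q x" for n x
    by (intro DERIV_imp_deriv DERIV_mult poly_DERIV smooth_closure_deriv(2) cutoff_smooth)
  show ?thesis
  proof (rule that[of "D + (L * C + L * C)"])
    fix n :: nat and x :: real assume x: "x \<in> {-1<..<1}"
    let ?m = "real (Suc n)"
    let ?s = "?m * x + real n" and ?t = "- ?m * x + real n"
    have s: "?s + 1 = ?m * (1 + x)" "?t + 1 = ?m * (1 - x)" by (auto simp: algebra_simps)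
    have "?s + 1 \<ge> 0" "?t + 1 \<ge> 0" unfolding s using x by auto
    then have st: "?s \<ge> -1" "?t \<ge> -1" by linarith+
    have "\<bar>?m * deriv smooth_step ?s * smooth_step ?t * poly q x\<bar>
        = ?m * \<bar>deriv smooth_step ?s\<bar> * smooth_step ?t * \<bar>poly q x\<bar>"
      using smooth_step_range by (simp add: abs_mult)
    also have "\<dots> \<le> ?m * \<bar>deriv smooth_step ?s\<bar> * 1 * (L * (1 + x))"
      using smooth_step_range L(2)[of x "-1"] x q by (intro mult_mono) (auto simp: add.commute)
    also have "\<dots> = L * ((?s + 1) * \<bar>deriv smooth_step ?s\<bar>)" unfolding s by simp
    also have "\<dots> \<le> L * C" using L(1) C(2)[OF st(1)] by (rule mult_left_mono[rotated])
    finally have 1: "\<bar>?m * deriv smooth_step ?s * smooth_step ?t * poly q x\<bar> \<le> L * C" .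
    have "\<bar>?m * deriv smooth_step ?t * smooth_step ?s * poly q x\<bar>
        = ?m * \<bar>deriv smooth_step ?t\<bar> * smooth_step ?s * \<bar>poly q x\<bar>"
      using smooth_step_range by (simp add: abs_mult)
    also have "\<dots> \<le> ?m * \<bar>deriv smooth_step ?t\<bar> * 1 * (L * (1 - x))"
      using smooth_step_range L(2)[of x 1] x q by (intro mult_mono) auto
    also have "\<dots> = L * ((?t + 1) * \<bar>deriv smooth_step ?t\<bar>)" unfolding s by simp
    also have "\<dots> \<le> L * C" using L(1) C(2)[OF st(2)] by (rule mult_left_mono[rotated])
    finally have 2: "\<bar>?m * deriv smooth_step ?t * smooth_step ?s * poly q x\<bar> \<le> L * C" .
    have "\<bar>poly (pderiv q) x * cutoff n x\<bar> \<le> D * 1"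
      unfolding abs_mult using D x cutoff_range[of n x] by (intro mult_mono) auto
    moreover have "\<bar>deriv (cutoff n) x * poly q x\<bar> \<le> L * C + L * C"
      using 1 2 unfolding deriv_cutoff left_diff_distrib by linarith
    ultimately show "\<bar>deriv (\<lambda>x. poly q x * cutoff n x) x\<bar> \<le> D + (L * C + L * C)"
      unfolding dv by linarith
  next
    fix x :: real assume x: "x \<in> {-1<..<1}"
    have "eventually (\<lambda>n. real n > 2 / (1 + x)) sequentially" "eventually (\<lambda>n. real n > 2 / (1 - x)) sequentially"
      using eventually_gt_at_top filterlim_real_sequentially filterlim_at_top_dense by metis+
    then have ev: "eventually (\<lambda>n. real (Suc n) * x + real n > 1 \<and> - real (Suc n) * x + real n > 1) sequentially"
    proof eventually_elim
      case (elim n)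
      then have "real n * (1 + x) > 2" "real n * (1 - x) > 2" using x by (auto simp: field_simps)
      with x show ?case by (auto simp: algebra_simps)
    qed
    then have 1: "eventually (\<lambda>n. cutoff n x = 1 \<and> deriv (cutoff n) x = 0) sequentially"
      by eventually_elim (auto simp: cutoff_def deriv_cutoff smooth_step_1 smooth_step_deriv_0 simp del: of_nat_Suc)
    show "(\<lambda>n. deriv (\<lambda>x. poly q x * cutoff n x) x) \<longlonglongrightarrow> poly (pderiv q) x"
      by (rule tendsto_eventually) (use 1 in \<open>eventually_elim, auto simp: dv\<close>)
    show "(\<lambda>n. poly q x * cutoff n x) \<longlonglongrightarrow> poly q x"
      by (rule tendsto_eventually) (use 1 in \<open>eventually_elim, auto\<close>)
  qed
qed

text \<open>Extends the defining identity of a distributional derivative from test functions to polynomials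
vanishing at \<open>\<plusminus>1\<close>, by dominated convergence on both sides along the cut off polynomials.\<close>

lemma distributional_derivative_poly:
  assumes g: "has_distributional_derivative g (P, Q)"
    and q: "poly q 1 = 0" "poly q (-1) = 0"
  shows "integral {-1<..<1} (\<lambda>x. g x * poly (pderiv q) x)
    = - (integral\<^sup>L P (poly q) - integral\<^sup>L Q (poly q))"
proof -
  let ?\<phi> = "\<lambda>n x. poly q x * cutoff n x"
  have gi: "g absolutely_integrable_on {-1<..<1}"
    and P: "finite_measure P" "sets P = sets (restrict_space borel {-1<..<1})"
    and Q: "finite_measure Q" "sets Q = sets (restrict_space borel {-1<..<1})"
    and dd: "\<And>\<phi>. test_function \<phi> \<Longrightarrow>
      integral {-1<..<1} (\<lambda>x. g x * deriv \<phi> x) = - (integral\<^sup>L P \<phi> - integral\<^sup>L Q \<phi>)"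
    using g unfolding has_distributional_derivative_def by auto
  obtain B where B: "\<And>n x. x \<in> {-1<..<1} \<Longrightarrow> \<bar>deriv (?\<phi> n) x\<bar> \<le> B"
    and lim1: "\<And>x. x \<in> {-1<..<1} \<Longrightarrow> (\<lambda>n. deriv (?\<phi> n) x) \<longlonglongrightarrow> poly (pderiv q) x"
    and lim0: "\<And>x. x \<in> {-1<..<1} \<Longrightarrow> (\<lambda>n. ?\<phi> n x) \<longlonglongrightarrow> poly q x"
    using poly_cutoff_deriv_bounded[OF q] by blast
  have sm: "smooth_closure (?\<phi> n)" for n
    by (intro smooth_closure.mult smooth_closure.poly cutoff_smooth)
  have "(\<lambda>n. integral {-1<..<1} (\<lambda>x. g x * deriv (?\<phi> n) x)) \<longlonglongrightarrow>
      integral {-1<..<1} (\<lambda>x. g x * poly (pderiv q) x)"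
  proof (rule dominated_convergence(2))
    fix n
    have "(\<lambda>x. deriv (?\<phi> n) x * g x) absolutely_integrable_on {-1<..<1}"
    proof (rule absolutely_integrable_bounded_measurable_product_real[OF _ _ _ gi])
      show "deriv (?\<phi> n) \<in> borel_measurable (lebesgue_on {-1<..<1})"
        by (intro continuous_imp_measurable_on_sets_lebesgue smooth_closure_continuous
            smooth_closure_deriv sm) auto
      show "bounded (deriv (?\<phi> n) ` {-1<..<1})"
        unfolding bounded_iff using B by (intro exI[of _ B]) auto
    qed auto
    then show "(\<lambda>x. g x * deriv (?\<phi> n) x) integrable_on {-1<..<1}"
      by (simp add: mult.commute set_lebesgue_integral_eq_integral(1))
    show "norm (g x * deriv (?\<phi> n) x) \<le> B * norm (g x)" if "x \<in> {-1<..<1}" for x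
      using mult_right_mono[OF B[OF that, of n], of "\<bar>g x\<bar>"] by (simp add: abs_mult mult.commute)
    show "(\<lambda>x. B * norm (g x)) integrable_on {-1<..<1}"
      using gi by (intro integrable_on_mult_right) (auto simp: absolutely_integrable_on_def)
    show "(\<lambda>n. g x * deriv (?\<phi> n) x) \<longlonglongrightarrow> g x * poly (pderiv q) x" if "x \<in> {-1<..<1}" for x
      by (intro tendsto_mult_left lim1 that)
  qed
  moreover have lim: "(\<lambda>n. integral\<^sup>L M (?\<phi> n)) \<longlonglongrightarrow> integral\<^sup>L M (poly q)"
    if M: "finite_measure M" "sets M = sets (restrict_space borel {-1<..<1})" for M
  proof -
    interpret finite_measure M by fact
    have meas: "h \<in> borel_measurable M" if "continuous_on UNIV h" for h :: "real \<Rightarrow> real"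
    proof -
      have "h \<in> borel_measurable borel" using that by (rule borel_measurable_continuous_onI)
      then have "h \<in> borel_measurable (restrict_space borel {-1<..<1})" by (rule measurable_restrict_space1)
      then show ?thesis using measurable_cong_sets[OF M(2) refl] by blast
    qed
    have sp: "space M = {-1<..<1}" using sets_eq_imp_space_eq[OF M(2)] by (simp add: space_restrict_space)
    have "bounded (poly q ` {-1..1})"
      by (intro compact_imp_bounded compact_continuous_image) (auto intro!: continuous_intros)
    then obtain C where "\<forall>y\<in>poly q ` {-1..1}. norm y \<le> C"
      unfolding bounded_iff by blast
    then have C: "\<And>x. x \<in> {-1..1} \<Longrightarrow> \<bar>poly q x\<bar> \<le> C" by simp
    show ?thesis
    proof (rule integral_dominated_convergence[where w = "\<lambda>_. C"])
      show "poly q \<in> borel_measurable M" by (intro meas continuous_intros)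
      show "?\<phi> n \<in> borel_measurable M" for n by (intro meas smooth_closure_continuous sm)
      show "AE x in M. (\<lambda>n. ?\<phi> n x) \<longlonglongrightarrow> poly q x" using lim0 by (auto simp: sp)
      show "AE x in M. norm (?\<phi> n x) \<le> C" for n
      proof (rule AE_I2)
        fix x assume "x \<in> space M"
        then have "\<bar>poly q x\<bar> \<le> C" using C[of x] by (simp add: sp)
        moreover have "\<bar>poly q x * cutoff n x\<bar> \<le> \<bar>poly q x\<bar> * 1"
          unfolding abs_mult using cutoff_range[of n x] by (intro mult_left_mono) auto
        ultimately show "norm (?\<phi> n x) \<le> C" by simp
      qed
    qed simp
  qed
  then have "(\<lambda>n. - (integral\<^sup>L P (?\<phi> n) - integral\<^sup>L Q (?\<phi> n))) \<longlonglongrightarrow>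
      - (integral\<^sup>L P (poly q) - integral\<^sup>L Q (poly q))"
    by (intro tendsto_intros lim P Q)
  ultimately show ?thesis
    unfolding dd[OF test_function_poly_cutoff] by (rule LIMSEQ_unique)
qed

section \<open>Integrals against a signed measure and its total variation\<close>

lemma integral_mono_measure_on:
  fixes u :: "'a \<Rightarrow> real"
  assumes "finite_measure P" "finite_measure Q" and sets: "sets Q = sets P"
    and A: "A \<in> sets P" and le: "\<And>X. X \<in> sets P \<Longrightarrow> X \<subseteq> A \<Longrightarrow> emeasure Q X \<le> emeasure P X"
    and u: "u \<in> borel_measurable P" "\<And>x. x \<in> space P \<Longrightarrow> 0 \<le> u x" "\<And>x. x \<in> space P \<Longrightarrow> u x \<le> C"
  shows "(\<integral>x. u x * indicator A x \<partial>Q) \<le> (\<integral>x. u x * indicator A x \<partial>P)"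
proof -
  interpret P: finite_measure P by fact
  interpret Q: finite_measure Q by fact
  have sp: "space Q = space P" by (rule sets_eq_imp_space_eq[OF sets])
  have AQ: "A \<in> sets Q" using A sets by simp
  have int: "integrable M (\<lambda>x. u x * indicator A x)"
    if "finite_measure M" "sets M = sets P" for M :: "'a measure"
  proof -
    interpret finite_measure M by fact
    have "u \<in> borel_measurable M" "A \<in> sets M"
      using u(1) A measurable_cong_sets[OF that(2) refl] that(2) by auto
    moreover have "AE x in M. norm (u x * indicator A x) \<le> \<bar>C\<bar>"
      using u(2,3) sets_eq_imp_space_eq[OF that(2)]
      by (intro AE_I2) (fastforce simp: indicator_def abs_mult)
    ultimately show ?thesis by (intro integrable_const_bound) auto
  qed
  have "restrict_space Q A \<le> restrict_space P A"
    using A le by (subst le_measure) (auto simp: sets sets_restrict_space emeasure_restrict_space sp sets.Int_space_eq2)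
  then have "(\<integral>\<^sup>+x. ennreal (u x) \<partial>restrict_space Q A) \<le> (\<integral>\<^sup>+x. ennreal (u x) \<partial>restrict_space P A)"
    by (intro nn_integral_mono_measure) (auto simp: sets sets_restrict_space)
  then have le': "(\<integral>\<^sup>+x. ennreal (u x) * indicator A x \<partial>Q) \<le> (\<integral>\<^sup>+x. ennreal (u x) * indicator A x \<partial>P)"
    using A AQ by (simp add: nn_integral_restrict_space)
  have eq: "ennreal (\<integral>x. u x * indicator A x \<partial>M) = (\<integral>\<^sup>+x. ennreal (u x) * indicator A x \<partial>M)"
    if M: "finite_measure M" "sets M = sets P" for M
  proof -
    have "(\<integral>\<^sup>+x. ennreal (u x * indicator A x) \<partial>M) = ennreal (\<integral>x. u x * indicator A x \<partial>M)"
      using u(2) sets_eq_imp_space_eq[OF M(2)] by (intro nn_integral_eq_integral int M AE_I2) (auto simp: indicator_def)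
    moreover have "(\<integral>\<^sup>+x. ennreal (u x * indicator A x) \<partial>M) = (\<integral>\<^sup>+x. ennreal (u x) * indicator A x \<partial>M)"
      by (intro nn_integral_cong) (auto simp: indicator_def)
    ultimately show ?thesis by simp
  qed
  have "ennreal (\<integral>x. u x * indicator A x \<partial>Q) \<le> ennreal (\<integral>x. u x * indicator A x \<partial>P)"
    using le' eq[OF assms(1)] eq[OF assms(2) sets] by simp
  moreover have "0 \<le> (\<integral>x. u x * indicator A x \<partial>P)"
    using u(2) by (intro integral_nonneg_AE AE_I2) auto
  ultimately show ?thesis by simp
qed

text \<open>Monotonicity in the measure is applied to the two nonnegative functions \<open>M + \<psi>\<close> and \<open>M - \<psi>\<close>.\<close>

lemma integral_diff_le_on_dominated_set:
  fixes \<psi> :: "'a \<Rightarrow> real"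
  assumes P: "finite_measure P" and Q: "finite_measure Q" and sets: "sets Q = sets P"
    and A: "A \<in> sets P" and le: "\<And>X. X \<in> sets P \<Longrightarrow> X \<subseteq> A \<Longrightarrow> emeasure Q X \<le> emeasure P X"
    and meas: "\<psi> \<in> borel_measurable P" and M: "\<And>x. x \<in> space P \<Longrightarrow> \<bar>\<psi> x\<bar> \<le> M"
  shows "\<bar>(\<integral>x. \<psi> x * indicator A x \<partial>P) - (\<integral>x. \<psi> x * indicator A x \<partial>Q)\<bar> \<le> M * (measure P A - measure Q A)"
proof -
  have int: "integrable N (\<lambda>x. \<psi> x * indicator A x)" "integrable N (\<lambda>x. M * indicator A x)"
    if "finite_measure N" "sets N = sets P" for N :: "'a measure"
  proof -
    interpret finite_measure N by fact
    have "\<psi> \<in> borel_measurable N" "A \<in> sets N"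
      using meas A measurable_cong_sets[OF that(2) refl] that(2) by auto
    moreover have "AE x in N. norm (\<psi> x * indicator A x) \<le> \<bar>M\<bar>"
      using M sets_eq_imp_space_eq[OF that(2)]
      by (intro AE_I2) (fastforce simp: indicator_def abs_mult)
    ultimately show "integrable N (\<lambda>x. \<psi> x * indicator A x)" "integrable N (\<lambda>x. M * indicator A x)"
      by (intro integrable_const_bound, auto) 
        (auto intro!: integrable_mult_right integrable_real_indicator simp: less_top[symmetric])
  qed
  have ev: "(\<integral>x. (M + s * \<psi> x) * indicator A x \<partial>N) = M * measure N A + s * (\<integral>x. \<psi> x * indicator A x \<partial>N)"
    if "finite_measure N" "sets N = sets P" for N and s :: real
  proof -
    have "(\<integral>x. (M + s * \<psi> x) * indicator A x \<partial>N)
      = (\<integral>x. M * indicator A x + s * (\<psi> x * indicator A x) \<partial>N)"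
      by (simp add: algebra_simps)
    also have "\<dots> = M * measure N A + s * (\<integral>x. \<psi> x * indicator A x \<partial>N)"
      using int[OF that] A that(2) by (subst Bochner_Integration.integral_add) auto
    finally show ?thesis .
  qed
  have "(\<integral>x. (M + s * \<psi> x) * indicator A x \<partial>Q) \<le> (\<integral>x. (M + s * \<psi> x) * indicator A x \<partial>P)"
    if s: "s = 1 \<or> s = -1" for s
  proof (rule integral_mono_measure_on[OF P Q sets A le])
    show "(\<lambda>x. M + s * \<psi> x) \<in> borel_measurable P" using meas by simp
    show "0 \<le> M + s * \<psi> x" "M + s * \<psi> x \<le> 2 * M" if "x \<in> space P" for x
      using M[OF that] s by auto
  qed
  from this[of 1] this[of "-1"] show ?thesis
    unfolding ev[OF P refl] ev[OF Q sets] by (simp add: algebra_simps abs_le_iff)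
qed

text \<open>The supremum in the definition of the total variation is taken over a bounded set, since every sum
is at most the total mass of the two measures.\<close>

lemma signed_total_variation_upper:
  assumes P: "finite_measure P" and Q: "finite_measure Q" and sets: "sets Q = sets P"
    and E: "finite \<E>" "\<E> \<subseteq> sets P" "disjoint \<E>" "\<Union>\<E> = space P"
  shows "(\<Sum>E\<in>\<E>. \<bar>measure P E - measure Q E\<bar>) \<le> signed_total_variation (P, Q)"
  unfolding signed_total_variation_def prod.case
proof (rule cSup_upper)
  show "bdd_above {\<Sum>E\<in>\<E>. \<bar>measure P E - measure Q E\<bar> |\<E>.
      finite \<E> \<and> \<E> \<subseteq> sets P \<and> disjoint \<E> \<and> \<Union>\<E> = space P}"
  proof (rule bdd_aboveI[where M = "measure P (space P) + measure Q (space P)"], clarify)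
    fix \<E> assume E: "finite \<E>" "\<E> \<subseteq> sets P" "disjoint \<E>" "\<Union>\<E> = space P"
    have m: "(\<Sum>E\<in>\<E>. measure M E) = measure M (space P)"
      if M: "finite_measure M" "sets M = sets P" for M
    proof -
      interpret finite_measure M by fact
      have "measure M (\<Union>E\<in>\<E>. E) = (\<Sum>E\<in>\<E>. measure M E)"
        using E M by (intro finite_measure_finite_Union) (auto simp: disjoint_family_on_def disjoint_def)
      then show ?thesis using E(4) by simp
    qed
    have "(\<Sum>E\<in>\<E>. \<bar>measure P E - measure Q E\<bar>) \<le> (\<Sum>E\<in>\<E>. measure P E + measure Q E)"
    proof (rule sum_mono)
      fix E assume "E \<in> \<E>"
      show "\<bar>measure P E - measure Q E\<bar> \<le> measure P E + measure Q E"
        using measure_nonneg[of P E] measure_nonneg[of Q E] by linarith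
    qed
    also have "\<dots> = measure P (space P) + measure Q (space P)"
      using m[OF P refl] m[OF Q sets] by (simp add: sum.distrib)
    finally show "(\<Sum>E\<in>\<E>. \<bar>measure P E - measure Q E\<bar>) \<le> measure P (space P) + measure Q (space P)" .
  qed
qed (use E in blast)

text \<open>A Hahn decomposition splits the space into a set on which \<open>P\<close> dominates \<open>Q\<close> and one on which \<open>Q\<close>
dominates \<open>P\<close>. On each of them the difference of the integrals is at most \<open>M\<close> times the difference
of the masses, and the two-set partition is one of those that define the total variation.\<close>

lemma abs_integral_diff_le_total_variation:
  fixes \<psi> :: "real \<Rightarrow> real"
  assumes P: "finite_measure P" and Q: "finite_measure Q" and sets: "sets Q = sets P"
    and meas: "\<psi> \<in> borel_measurable P" and M: "\<And>x. x \<in> space P \<Longrightarrow> \<bar>\<psi> x\<bar> \<le> M"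
    and M0: "M \<ge> 0"
  shows "\<bar>integral\<^sup>L P \<psi> - integral\<^sup>L Q \<psi>\<bar> \<le> M * signed_total_variation (P, Q)"
proof -
  have sp: "space Q = space P" by (rule sets_eq_imp_space_eq[OF sets])
  have measQ: "\<psi> \<in> borel_measurable Q" using meas measurable_cong_sets[OF sets refl] by blast
  obtain Y where Y0: "Y \<in> sets P"
    and Y1: "\<forall>X\<in>sets P. X \<subseteq> Y \<longrightarrow> emeasure Q X \<le> emeasure P X"
    and Y2: "\<forall>X\<in>sets P. X \<inter> Y = {} \<longrightarrow> emeasure P X \<le> emeasure Q X"
    by (rule bexE[OF finite_unsigned_Hahn_decomposition[OF P Q sets]], elim conjE)
  define Z where "Z = space P - Y"
  have Z: "Z \<in> sets P" using Y0 by (simp add: Z_def)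
  have 1: "\<bar>(\<integral>x. \<psi> x * indicator Y x \<partial>P) - (\<integral>x. \<psi> x * indicator Y x \<partial>Q)\<bar> \<le> M * (measure P Y - measure Q Y)"
    using Y0 Y1 by (intro integral_diff_le_on_dominated_set[OF P Q sets _ _ meas M]) simp_all
  have 2: "\<bar>(\<integral>x. \<psi> x * indicator Z x \<partial>Q) - (\<integral>x. \<psi> x * indicator Z x \<partial>P)\<bar> \<le> M * (measure Q Z - measure P Z)"
  proof (rule integral_diff_le_on_dominated_set[OF Q P sets[symmetric]])
    fix X assume "X \<in> sets Q" "X \<subseteq> Z"
    moreover from this(2) have "X \<inter> Y = {}" by (auto simp: Z_def)
    ultimately show "emeasure P X \<le> emeasure Q X" using Y2 sets by simp
  qed (use Z measQ M in \<open>simp_all add: sets sp\<close>)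
  have split: "integral\<^sup>L N \<psi> = (\<integral>x. \<psi> x * indicator Y x \<partial>N) + (\<integral>x. \<psi> x * indicator Z x \<partial>N)"
    if N: "finite_measure N" "sets N = sets P" for N
  proof -
    interpret finite_measure N by fact
    have spN: "space N = space P" by (rule sets_eq_imp_space_eq[OF N(2)])
    have "\<psi> \<in> borel_measurable N" "Y \<in> sets N" "Z \<in> sets N"
      using meas Y0 Z measurable_cong_sets[OF N(2) refl] N(2) by auto
    moreover have "AE x in N. norm (\<psi> x * indicator A x) \<le> M" for A
      using M M0 spN by (intro AE_I2) (auto simp: indicator_def abs_mult)
    ultimately have "integrable N (\<lambda>x. \<psi> x * indicator Y x)" "integrable N (\<lambda>x. \<psi> x * indicator Z x)"
      by (auto intro!: integrable_const_bound)
    then have "(\<integral>x. \<psi> x * indicator Y x \<partial>N) + (\<integral>x. \<psi> x * indicator Z x \<partial>N)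
       = (\<integral>x. \<psi> x * indicator Y x + \<psi> x * indicator Z x \<partial>N)" by simp
    also have "\<dots> = integral\<^sup>L N \<psi>"
      by (rule Bochner_Integration.integral_cong) (auto simp: Z_def spN indicator_def)
    finally show ?thesis by simp
  qed
  have "M * (measure P Y - measure Q Y) + M * (measure Q Z - measure P Z)
      \<le> M * (\<bar>measure P Y - measure Q Y\<bar> + \<bar>measure P Z - measure Q Z\<bar>)"
    using M0 unfolding distrib_left[symmetric] by (intro mult_left_mono) auto
  also have "\<dots> \<le> M * signed_total_variation (P, Q)"
  proof (rule mult_left_mono[OF _ M0])
    have "\<bar>measure P Y - measure Q Y\<bar> + \<bar>measure P Z - measure Q Z\<bar> = (\<Sum>E\<in>{Y, Z}. \<bar>measure P E - measure Q E\<bar>)"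
    \<comment> \<open>the two sets can only coincide when the space is empty\<close>
    proof (cases "Y = Z")
      case True
      then have "Y = {}" by (auto simp: Z_def)
      with True show ?thesis by simp
    qed simp
    also have "\<dots> \<le> signed_total_variation (P, Q)"
      using Y0 Z sets.sets_into_space[OF Y0]
      by (intro signed_total_variation_upper P Q sets) (auto simp: disjoint_def Z_def)
    finally show "\<bar>measure P Y - measure Q Y\<bar> + \<bar>measure P Z - measure Q Z\<bar> \<le> signed_total_variation (P, Q)" .
  qed
  finally show ?thesis
    using 1 2 unfolding split[OF P refl] split[OF Q sets] by linarith
qed

section \<open>Functions of bounded variation have a distributional derivative\<close>

text \<open>For a monotone \<open>p\<close> this is the limit from the right, hence the right-continuous version of \<open>p\<close>.\<close>

definition right_limit :: "(real \<Rightarrow> real) \<Rightarrow> real \<Rightarrow> real" where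
  "right_limit p x = Inf (p ` {x<..})"

lemma
  assumes p: "mono p"
  shows right_limit_le: "x < y \<Longrightarrow> right_limit p x \<le> p y"
    and le_right_limit: "p x \<le> right_limit p x"
proof -
  have bdd: "bdd_below (p ` {x<..})" for x
    by (rule bdd_belowI[of _ "p x"]) (use p in \<open>auto simp: mono_def\<close>)
  show "x < y \<Longrightarrow> right_limit p x \<le> p y"
    unfolding right_limit_def by (intro cInf_lower bdd) auto
  show "p x \<le> right_limit p x"
    unfolding right_limit_def by (rule cInf_greatest) (use p in \<open>auto simp: mono_def\<close>)
qed

lemma mono_right_limit:
  assumes p: "mono p"
  shows "mono (right_limit p)"
proof (rule monoI)
  fix x y :: real assume "x \<le> y"
  then show "right_limit p x \<le> right_limit p y"
    using right_limit_le[OF p, of x y] le_right_limit[OF p, of y] by (cases "x = y") auto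
qed

lemma right_limit_right_continuous:
  assumes p: "mono p"
  shows "continuous (at_right a) (right_limit p)"
  unfolding continuous_within
proof (rule order_tendstoI)
  fix c assume c: "c < right_limit p a"
  show "\<forall>\<^sub>F x in at_right a. c < right_limit p x"
    unfolding eventually_at_right_field
  proof (intro exI[of _ "a + 1"] conjI allI impI)
    fix y assume "a < y"
    then show "c < right_limit p y"
      using c monoD[OF mono_right_limit[OF p], of a y] by linarith
  qed simp
next
  fix c assume c: "right_limit p a < c"
  then obtain y where y: "y > a" "p y < c"
    unfolding right_limit_def using cInf_lessD[of "p ` {a<..}" c] by auto
  show "\<forall>\<^sub>F x in at_right a. right_limit p x < c"
    unfolding eventually_at_right_field
  proof (intro exI[of _ y] conjI allI impI)
    fix x assume "a < x" "x < y"
    then show "right_limit p x < c"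
      using y right_limit_le[OF p, of x y] by linarith
  qed fact
qed

lemma right_limit_eq:
  assumes p: "mono p" and "isCont p x"
  shows "right_limit p x = p x"
proof (rule antisym)
  have "(p \<longlongrightarrow> p x) (at_right x)"
    using assms(2) by (auto simp: isCont_def filterlim_at_split)
  moreover have "eventually (\<lambda>y. right_limit p x \<le> p y) (at_right x)"
    unfolding eventually_at_right_field by (intro exI[of _ "x + 1"]) (auto intro: right_limit_le[OF p])
  ultimately show "right_limit p x \<le> p x"
    by (intro tendsto_lowerbound) auto
qed (rule le_right_limit[OF p])

lemma negligible_right_limit_neq:
  assumes "mono p"
  shows "negligible {x. right_limit p x \<noteq> p x}"
proof -
  have "{x. right_limit p x \<noteq> p x} \<subseteq> {x. \<not> isCont p x}"
    using right_limit_eq[OF assms] by auto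
  with mono_ctble_discont[OF assms] have "countable {x. right_limit p x \<noteq> p x}"
    by (rule countable_subset[rotated])
  then show ?thesis
    unfolding negligible_iff_null_sets by (intro null_sets_completionI countable_imp_null_set_lborel)
qed

lemma finite_measure_interval_measure_Ioo:
  assumes F: "mono F" "\<And>a. continuous (at_right a) F"
  shows "finite_measure (restrict_space (interval_measure F) {a<..<b})"
proof (rule finite_measureI)
  have mono: "\<And>x y. x \<le> y \<Longrightarrow> F x \<le> F y" using F(1) by (auto simp: mono_def)
  have "emeasure (interval_measure F) {a<..<b} \<le> emeasure (interval_measure F) {a<..b}"
    by (intro emeasure_mono) auto
  also have "\<dots> < \<infinity>" by (simp add: emeasure_interval_measure_Ioc_eq[OF mono F(2)])
  finally show "emeasure (restrict_space (interval_measure F) {a<..<b})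
      (space (restrict_space (interval_measure F) {a<..<b})) \<noteq> \<infinity>"
    by (simp add: emeasure_restrict_space space_restrict_space)
qed

text \<open>Both sides are evaluations, in the two orders, of the double integral of \<open>\<phi>' x\<close> over the triangle
\<open>t \<le> x \<le> 1\<close> with respect to \<open>dF t\<close> and \<open>dx\<close>: integrating first in \<open>x\<close> gives \<open>- \<phi> t\<close>, integrating
first in \<open>t\<close> gives \<open>(F x - F (-1)) \<phi>' x\<close>. The constant \<open>F (-1)\<close> drops out because \<open>\<phi>\<close> vanishes at
both end points.\<close>

lemma stieltjes_integration_by_parts:
  fixes F :: "real \<Rightarrow> real" and \<phi> :: "real \<Rightarrow> real"
  assumes F: "mono F" "\<And>a. continuous (at_right a) F"
    and d: "\<And>x. (\<phi> has_real_derivative \<phi>' x) (at x)" and c: "continuous_on UNIV \<phi>'"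
    and z: "\<phi> (-1) = 0" "\<phi> 1 = 0"
  defines "P \<equiv> restrict_space (interval_measure F) {-1<..<1}"
  shows "integral {-1<..<1} (\<lambda>x. F x * \<phi>' x) = - integral\<^sup>L P \<phi>"
proof -
  let ?I = "{-1<..<1} :: real set"
  have mono: "\<And>x y. x \<le> y \<Longrightarrow> F x \<le> F y" using F(1) by (auto simp: mono_def)
  note ioc = emeasure_interval_measure_Ioc[OF _ mono F(2)]
  have sp: "space P = ?I" by (simp add: P_def space_restrict_space)
  have setsP: "sets P = sets (restrict_space borel ?I)"
    unfolding P_def by (rule sets_restrict_space_cong) simp
  have fin: "finite_measure P"
    unfolding P_def by (rule finite_measure_interval_measure_Ioo[OF F])
  interpret P: finite_measure P by (rule fin)
  interpret L: sigma_finite_measure lborel by (rule lborel.sigma_finite_measure_axioms)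
  interpret PL: pair_sigma_finite P lborel ..
  have subI: "A \<in> sets borel \<Longrightarrow> A \<inter> ?I \<in> sets P" for A
    by (simp add: setsP sets_restrict_space image_iff) (metis Int_commute)
  have idP: "(\<lambda>x. x) \<in> borel_measurable P"
    unfolding P_def by (intro measurable_restrict_space1) simp
  have c'm: "\<phi>' \<in> borel_measurable borel" using c by (rule borel_measurable_continuous_onI)
  have "bounded (\<phi>' ` {-1..1})"
    using c by (intro compact_imp_bounded compact_continuous_image) (auto intro: continuous_on_subset)
  then obtain B where "\<forall>y\<in>\<phi>' ` {-1..1}. norm y \<le> B" unfolding bounded_iff by blast
  then have B: "\<And>x. x \<in> {-1..1} \<Longrightarrow> \<bar>\<phi>' x\<bar> \<le> B" by simp
  define G where "G t x = indicator {t..1} x * \<phi>' x" for t x :: real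
  have Gm: "case_prod G \<in> borel_measurable (P \<Otimes>\<^sub>M lborel)"
  proof -
    have [measurable]: "(\<lambda>z. fst z) \<in> borel_measurable (P \<Otimes>\<^sub>M lborel)"
      by (rule measurable_compose[OF measurable_fst idP])
    have [measurable]: "\<phi>' \<in> borel_measurable borel" by (rule c'm)
    have "case_prod G = (\<lambda>z. (if fst z \<le> snd z \<and> snd z \<le> 1 then \<phi>' (snd z) else 0))"
      by (auto simp: G_def fun_eq_iff indicator_def)
    also have "\<dots> \<in> borel_measurable (P \<Otimes>\<^sub>M lborel)" by measurable
    finally show ?thesis .
  qed
  have Gi: "integrable (P \<Otimes>\<^sub>M lborel) (case_prod G)"
  proof (rule Bochner_Integration.integrable_bound[OF _ Gm])
    have "emeasure (P \<Otimes>\<^sub>M lborel) (space P \<times> {-1..1::real}) < \<infinity>"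
      by (subst lborel.emeasure_pair_measure_Times)
        (auto simp: ennreal_mult_less_top P.emeasure_eq_measure)
    moreover have "space P \<times> {-1..1::real} \<in> sets (P \<Otimes>\<^sub>M lborel)"
      by (intro pair_measureI) auto
    ultimately show "integrable (P \<Otimes>\<^sub>M lborel) (\<lambda>z. B * indicator (space P \<times> {-1..1::real}) z)"
      by (intro integrable_mult_right integrable_real_indicator)
    show "AE z in P \<Otimes>\<^sub>M lborel. norm (case_prod G z) \<le> norm (B * indicator (space P \<times> {-1..1::real}) z)"
    proof (rule AE_I2)
      fix z :: "real \<times> real" assume z: "z \<in> space (P \<Otimes>\<^sub>M lborel)"
      obtain t x where tx: "z = (t, x)" by force
      with z have t: "t \<in> ?I" by (simp add: space_pair_measure sp)
      show "norm (case_prod G z) \<le> norm (B * indicator (space P \<times> {-1..1::real}) z)"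
      proof (cases "x \<in> {t..1}")
        case True
        then have "x \<in> {-1..1}" using t by auto
        then have "\<bar>\<phi>' x\<bar> \<le> \<bar>B\<bar>" using B[of x] by simp
        with True \<open>x \<in> {-1..1}\<close> t show ?thesis by (simp add: tx G_def sp)
      qed (simp add: tx G_def)
    qed
  qed
  have si: "set_integrable lborel ?I (\<lambda>x. (F x - k) * \<phi>' x)" for k
    unfolding set_integrable_def
  proof (rule Bochner_Integration.integrable_bound)
    show "integrable lborel (\<lambda>x. ((\<bar>F 1\<bar> + \<bar>F (-1)\<bar> + \<bar>k\<bar>) * \<bar>B\<bar>) * indicator ?I x)"
      by (intro integrable_mult_right integrable_real_indicator) auto
    have [measurable]: "F \<in> borel_measurable borel" by (rule borel_measurable_mono[OF F(1)])
    have [measurable]: "\<phi>' \<in> borel_measurable borel" by (rule c'm)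
    show "(\<lambda>x. indicator ?I x *\<^sub>R ((F x - k) * \<phi>' x)) \<in> borel_measurable lborel" by simp
    show "AE x in lborel. norm (indicator ?I x *\<^sub>R ((F x - k) * \<phi>' x))
        \<le> norm (((\<bar>F 1\<bar> + \<bar>F (-1)\<bar> + \<bar>k\<bar>) * \<bar>B\<bar>) * indicator ?I x)"
    proof (rule AE_I2)
      fix x
      show "norm (indicator ?I x *\<^sub>R ((F x - k) * \<phi>' x))
        \<le> norm (((\<bar>F 1\<bar> + \<bar>F (-1)\<bar> + \<bar>k\<bar>) * \<bar>B\<bar>) * indicator ?I x)"
      proof (cases "x \<in> ?I")
        case True
        have "\<bar>F x - k\<bar> * \<bar>\<phi>' x\<bar> \<le> (\<bar>F 1\<bar> + \<bar>F (-1)\<bar> + \<bar>k\<bar>) * \<bar>B\<bar>"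
          using mono[of "-1" x] mono[of x 1] B[of x] True by (intro mult_mono) auto
        with True show ?thesis by (simp add: abs_mult)
      qed simp
    qed
  qed
  have inner1: "(\<integral>x. G t x \<partial>lborel) = - \<phi> t" if t: "t \<in> ?I" for t
  proof -
    have "(\<integral>x. \<phi>' x * indicator {t..1} x \<partial>lborel) = \<phi> 1 - \<phi> t"
      by (rule integral_FTC_Icc_real) (use t d c in \<open>auto simp: continuous_on_eq_continuous_at\<close>)
    then show ?thesis by (simp add: G_def z mult.commute)
  qed
  have inner2: "(\<integral>t. G t x \<partial>P) = indicator ?I x * ((F x - F (-1)) * \<phi>' x)" if x: "x \<noteq> 1" for x
  proof -
    have "(\<integral>t. G t x \<partial>P) = (\<integral>t. (indicator {..1} x * \<phi>' x) * indicator ({..x} \<inter> ?I) t \<partial>P)"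
      by (rule Bochner_Integration.integral_cong) (auto simp: G_def indicator_def sp)
    also have "\<dots> = (indicator {..1} x * \<phi>' x) * measure P ({..x} \<inter> ?I)"
      using subI[of "{..x}"] by simp
    also have "\<dots> = indicator ?I x * ((F x - F (-1)) * \<phi>' x)"
    proof (cases "x \<in> ?I")
      case True
      then have "{..x} \<inter> ?I = {-1<..x}" by auto
      moreover have "measure P {-1<..x} = measure (interval_measure F) {-1<..x}"
        unfolding P_def using True by (intro measure_restrict_space) auto
      moreover have "measure (interval_measure F) {-1<..x} = F x - F (-1)"
        using True by (intro measure_interval_measure_Ioc mono F(2)) auto
      ultimately show ?thesis using True by simp
    next
      case False
      with x have "x > 1 \<or> {..x} \<inter> ?I = {}" by auto
      with False show ?thesis by auto
    qed
    finally show ?thesis .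
  qed
  have "- integral\<^sup>L P \<phi> = (\<integral>t. (\<integral>x. G t x \<partial>lborel) \<partial>P)"
    unfolding Bochner_Integration.integral_minus[symmetric]
    by (rule Bochner_Integration.integral_cong) (auto simp: inner1 sp)
  also have "\<dots> = (\<integral>x. (\<integral>t. G t x \<partial>P) \<partial>lborel)"
    using PL.Fubini_integral[OF Gi] by simp
  also have "\<dots> = (\<integral>x. indicator ?I x * ((F x - F (-1)) * \<phi>' x) \<partial>lborel)"
  proof (rule integral_cong_AE)
    show "(\<lambda>x. \<integral>t. G t x \<partial>P) \<in> borel_measurable lborel"
      using PL.integrable_snd[OF Gi] by simp
    have [measurable]: "F \<in> borel_measurable borel" by (rule borel_measurable_mono[OF F(1)])
    have [measurable]: "\<phi>' \<in> borel_measurable borel" by (rule c'm)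
    show "(\<lambda>x. indicator ?I x * ((F x - F (-1)) * \<phi>' x)) \<in> borel_measurable lborel" by simp
    have "AE x in lborel. x \<noteq> (1::real)" by (rule AE_lborel_singleton)
    then show "AE x in lborel. (\<integral>t. G t x \<partial>P) = indicator ?I x * ((F x - F (-1)) * \<phi>' x)"
      by eventually_elim (rule inner2)
  qed
  also have "\<dots> = integral ?I (\<lambda>x. (F x - F (-1)) * \<phi>' x)"
    using set_borel_integral_eq_integral(2)[OF si[of "F (-1)"]]
    by (simp add: set_lebesgue_integral_def)
  also have "\<dots> = integral ?I (\<lambda>x. F x * \<phi>' x)"
  proof -
    have "(\<phi>' has_integral (\<phi> 1 - \<phi> (-1))) {-1..1}"
      by (rule fundamental_theorem_of_calculus)
        (use d in \<open>auto simp flip: has_real_derivative_iff_has_vector_derivative intro: has_field_derivative_at_within\<close>)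
    then have "((\<lambda>x. F (-1) * \<phi>' x) has_integral F (-1) * 0) {-1..1}"
      using z by (intro has_integral_mult_right) simp
    then have h0: "((\<lambda>x. F (-1) * \<phi>' x) has_integral 0) ?I"
      by (simp add: has_integral_Icc_iff_Ioo)
    have "((\<lambda>x. (F x - F (-1)) * \<phi>' x) has_integral integral ?I (\<lambda>x. (F x - F (-1)) * \<phi>' x)) ?I"
      using set_borel_integral_eq_integral(1)[OF si] by (rule integrable_integral)
    from has_integral_add[OF this h0] show ?thesis
      by (simp add: left_diff_distrib integral_unique)
  qed
  finally show "integral ?I (\<lambda>x. F x * \<phi>' x) = - integral\<^sup>L P \<phi>" by simp
qed

text \<open>Jordan's decomposition: \<open>p\<close> is the variation of \<open>g\<close> on \<open>[a,x]\<close>, which grows on every interval by at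
least the increment of \<open>g\<close>, and \<open>q = p - g\<close>. Both are continued as constants outside \<open>[a,b]\<close>.\<close>

lemma bounded_variation_on_imp_mono_diff:
  assumes "bounded_variation_on {a..b} g" "a \<le> b"
  obtains p q where "mono p" "mono q" "\<And>x. x \<in> {a..b} \<Longrightarrow> g x = p x - q x"
proof -
  obtain B where B: "\<And>d. d division_of \<Union>d \<Longrightarrow> \<Union>d \<subseteq> {a..b} \<Longrightarrow> (\<Sum>k\<in>d. \<bar>g (Sup k) - g (Inf k)\<bar>) \<le> B"
    using assms(1) unfolding bounded_variation_on_def by blast
  define S where "S x = {(\<Sum>k\<in>d. \<bar>g (Sup k) - g (Inf k)\<bar>) | d. d division_of \<Union>d \<and> \<Union>d \<subseteq> {a..x}}" for x
  define V where "V x = Sup (S x)" for x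
  have ne: "0 \<in> S x" for x
    unfolding S_def by (auto intro!: exI[of _ "{}"])
  have bdd: "bdd_above (S x)" if "x \<le> b" for x
    unfolding S_def
  proof (rule bdd_aboveI[of _ B], clarify)
    fix d assume "d division_of \<Union>d" "\<Union>d \<subseteq> {a..x}"
    moreover from this(2) have "\<Union>d \<subseteq> {a..b}" by (rule order_trans) (use that in auto)
    ultimately show "(\<Sum>k\<in>d. \<bar>g (Sup k) - g (Inf k)\<bar>) \<le> B" by (intro B)
  qed
  have step: "V x + \<bar>g y - g x\<bar> \<le> V y" if xy: "a \<le> x" "x \<le> y" "y \<le> b" for x y
  proof (cases "x = y")
    case False
    with xy have "x < y" by simp
    have "V x \<le> V y - \<bar>g y - g x\<bar>"
      unfolding V_def[of x]
    proof (rule cSup_least)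
      fix s assume "s \<in> S x"
      then obtain d where d: "d division_of \<Union>d" "\<Union>d \<subseteq> {a..x}" "s = (\<Sum>k\<in>d. \<bar>g (Sup k) - g (Inf k)\<bar>)"
        unfolding S_def by blast
      have notin: "{x..y} \<notin> d"
      proof
        assume "{x..y} \<in> d"
        then have "y \<in> \<Union>d" using \<open>x < y\<close> by (intro UnionI) auto
        with d(2) have "y \<in> {a..x}" by (rule subsetD)
        with \<open>x < y\<close> show False by simp
      qed
      have "insert {x..y} d division_of \<Union>(insert {x..y} d)"
      proof (rule division_ofI)
        show "finite (insert {x..y} d)" using division_ofD(1)[OF d(1)] by simp
        show "\<exists>a b. K = cbox a b" if "K \<in> insert {x..y} d" for K
          using that division_ofD(4)[OF d(1)] by (metis box_real(2) insert_iff)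
        show "K \<noteq> {}" if "K \<in> insert {x..y} d" for K
          using that division_ofD(3)[OF d(1)] \<open>x < y\<close> by auto
        have int: "interior K \<inter> {x<..<y} = {}" if "K \<in> d" for K
        proof -
          have "interior K \<subseteq> {a..x}" using d(2) that interior_subset by blast
          then show ?thesis by auto
        qed
        show "interior K1 \<inter> interior K2 = {}"
          if "K1 \<in> insert {x..y} d" "K2 \<in> insert {x..y} d" "K1 \<noteq> K2" for K1 K2
          using that division_ofD(5)[OF d(1)] int
          by (metis Int_commute insert_iff interior_atLeastAtMost_real)
      qed auto
      moreover have "\<Union>(insert {x..y} d) \<subseteq> {a..y}"
      proof -
        have "{a..x} \<subseteq> {a..y}" "{x..y} \<subseteq> {a..y}" using xy by auto
        then show ?thesis using d(2) by (simp only: Union_insert Un_subset_iff) (meson order_trans)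
      qed
      ultimately have "(\<Sum>k\<in>insert {x..y} d. \<bar>g (Sup k) - g (Inf k)\<bar>) \<in> S y"
        unfolding S_def by blast
      then have "(\<Sum>k\<in>insert {x..y} d. \<bar>g (Sup k) - g (Inf k)\<bar>) \<le> V y"
        unfolding V_def by (intro cSup_upper bdd xy)
      then show "s \<le> V y - \<bar>g y - g x\<bar>"
        using division_ofD(1)[OF d(1)] notin xy by (simp add: d(3))
    qed (use ne in blast)
    then show ?thesis by simp
  qed simp
  define c where "c x = max a (min b x)" for x
  have c: "a \<le> c x" "c x \<le> b" "x \<le> y \<Longrightarrow> c x \<le> c y" for x y
    using assms(2) by (auto simp: c_def)
  show ?thesis
  proof (rule that[of "\<lambda>x. V (c x)" "\<lambda>x. V (c x) - g (c x)"])
    have "V (c x) + \<bar>g (c y) - g (c x)\<bar> \<le> V (c y)" if "x \<le> y" for x y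
      by (rule step[OF c(1) c(3)[OF that] c(2)])
    then have "V (c x) \<le> V (c y) \<and> V (c x) - g (c x) \<le> V (c y) - g (c y)" if "x \<le> y" for x y
      using that by (smt (verit))
    then show "mono (\<lambda>x. V (c x))" "mono (\<lambda>x. V (c x) - g (c x))"
      by (auto intro!: monoI)
    show "g x = V (c x) - (V (c x) - g (c x))" if "x \<in> {a..b}" for x
      using that by (simp add: c_def)
  qed
qed

lemma mono_absolutely_integrable_on_Ioo:
  fixes p :: "real \<Rightarrow> real"
  assumes "mono p"
  shows "p absolutely_integrable_on {a<..<b}"
proof -
  have [measurable]: "p \<in> borel_measurable borel" by (rule borel_measurable_mono[OF assms])
  have "set_integrable lborel {a<..<b} p"
    unfolding set_integrable_def
  proof (rule Bochner_Integration.integrable_bound)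
    show "integrable lborel (\<lambda>x. (\<bar>p a\<bar> + \<bar>p b\<bar>) * indicator {a<..<b} x)"
      using emeasure_lborel_box_finite[of a b]
      by (intro integrable_mult_right integrable_real_indicator) (auto simp: box_real)
    show "AE x in lborel. norm (indicator {a<..<b} x *\<^sub>R p x) \<le> norm ((\<bar>p a\<bar> + \<bar>p b\<bar>) * indicator {a<..<b} x)"
    proof (rule AE_I2)
      fix x
      show "norm (indicator {a<..<b} x *\<^sub>R p x) \<le> norm ((\<bar>p a\<bar> + \<bar>p b\<bar>) * indicator {a<..<b} x)"
        using monoD[OF assms, of a x] monoD[OF assms, of x b] by (auto simp: indicator_def)
    qed
  qed simp
  then show ?thesis
    by (auto simp: set_integrable_def intro: integrable_completion[THEN iffD2])
qed

lemma test_function_facts: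
  assumes "test_function \<phi>"
  shows "(\<phi> has_real_derivative deriv \<phi> x) (at x)" "continuous_on UNIV (deriv \<phi>)"
    "\<phi> (-1) = 0" "\<phi> 1 = 0"
proof -
  have d: "(deriv ^^ k) \<phi> differentiable_on UNIV" for k
    using assms unfolding test_function_def by auto
  have s: "closure {x. \<phi> x \<noteq> 0} \<subseteq> {-1<..<1}"
    using assms unfolding test_function_def by auto
  show "(\<phi> has_real_derivative deriv \<phi> x) (at x)"
    using d[of 0] by (auto simp: differentiable_on_def DERIV_deriv_iff_real_differentiable)
  show "continuous_on UNIV (deriv \<phi>)"
    using differentiable_imp_continuous_on[OF d[of 1]] by simp
  have "{x. \<phi> x \<noteq> 0} \<subseteq> {-1<..<1}" by (rule order_trans[OF closure_subset s])
  then show "\<phi> (-1) = 0" "\<phi> 1 = 0" by auto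
qed

text \<open>Passing to the right-continuous versions of the two monotone parts changes them only on a countable
set, so that almost everywhere \<open>g\<close> is a difference of distribution functions.\<close>

lemma distributional_derivative_exists:
  assumes g0: "bounded_variation_on {-1..1} g0" and E: "negligible E"
    and g: "\<And>x. x \<in> {-1..1} - E \<Longrightarrow> g x = g0 x"
  shows "\<exists>\<nu>. has_distributional_derivative g \<nu>"
proof -
  obtain p q where pq: "mono p" "mono q" "\<And>x. x \<in> {-1..1} \<Longrightarrow> g0 x = p x - q x"
    by (rule bounded_variation_on_imp_mono_diff[OF g0]) (simp, blast)
  define P where "P = restrict_space (interval_measure (right_limit p)) {-1<..<1}"
  define Q where "Q = restrict_space (interval_measure (right_limit q)) {-1<..<1}"
  note mono = mono_right_limit[OF pq(1)] mono_right_limit[OF pq(2)]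
  define N where "N = E \<union> {x. right_limit p x \<noteq> p x} \<union> {x. right_limit q x \<noteq> q x}"
  have N: "negligible N"
    unfolding N_def by (intro negligible_Un E negligible_right_limit_neq pq)
  have gN: "g x = right_limit p x - right_limit q x" if "x \<in> {-1<..<1} - N" for x
    using g[of x] pq(3)[of x] that by (auto simp: N_def)
  have ai: "right_limit p absolutely_integrable_on {-1<..<1}" "right_limit q absolutely_integrable_on {-1<..<1}"
    by (intro mono_absolutely_integrable_on_Ioo mono)+
  have "(\<lambda>x. right_limit p x - right_limit q x) absolutely_integrable_on {-1<..<1}"
    by (intro set_integral_diff ai)
  then have gai: "g absolutely_integrable_on {-1<..<1}"
    by (rule absolutely_integrable_spike[OF _ N]) (use gN in auto)
  have "integral {-1<..<1} (\<lambda>x. g x * deriv \<phi> x) = - (integral\<^sup>L P \<phi> - integral\<^sup>L Q \<phi>)"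
    if t: "test_function \<phi>" for \<phi>
  proof -
    note tf = test_function_facts[OF t]
    have "bounded (deriv \<phi> ` {-1..1})"
      using tf(2) by (intro compact_imp_bounded compact_continuous_image) (auto intro: continuous_on_subset)
    then have bd: "bounded (deriv \<phi> ` {-1<..<1})"
      by (rule bounded_subset) auto
    have i: "(\<lambda>x. deriv \<phi> x * right_limit h x) integrable_on {-1<..<1}"
      if "right_limit h absolutely_integrable_on {-1<..<1}" for h
      by (rule set_lebesgue_integral_eq_integral(1),
          rule absolutely_integrable_bounded_measurable_product_real[OF _ _ bd that])
        (use tf(2) in \<open>auto intro!: continuous_imp_measurable_on_sets_lebesgue intro: continuous_on_subset\<close>)
    have "integral {-1<..<1} (\<lambda>x. g x * deriv \<phi> x)
        = integral {-1<..<1} (\<lambda>x. right_limit p x * deriv \<phi> x - right_limit q x * deriv \<phi> x)"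
      by (rule integral_spike[OF N]) (use gN in \<open>auto simp: left_diff_distrib\<close>)
    also have "\<dots> = integral {-1<..<1} (\<lambda>x. right_limit p x * deriv \<phi> x)
        - integral {-1<..<1} (\<lambda>x. right_limit q x * deriv \<phi> x)"
      using i[OF ai(1)] i[OF ai(2)] by (intro Henstock_Kurzweil_Integration.integral_diff) (simp_all add: mult.commute)
    also have "integral {-1<..<1} (\<lambda>x. right_limit p x * deriv \<phi> x) = - integral\<^sup>L P \<phi>"
      unfolding P_def
      by (rule stieltjes_integration_by_parts[OF mono(1) right_limit_right_continuous[OF pq(1)] tf])
    also have "integral {-1<..<1} (\<lambda>x. right_limit q x * deriv \<phi> x) = - integral\<^sup>L Q \<phi>"
      unfolding Q_def
      by (rule stieltjes_integration_by_parts[OF mono(2) right_limit_right_continuous[OF pq(2)] tf])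
    finally show ?thesis by simp
  qed
  moreover have "finite_measure P" "finite_measure Q"
    unfolding P_def Q_def
    by (rule finite_measure_interval_measure_Ioo[OF mono(1) right_limit_right_continuous[OF pq(1)]],
        rule finite_measure_interval_measure_Ioo[OF mono(2) right_limit_right_continuous[OF pq(2)]])
  moreover have "sets P = sets (restrict_space borel {-1<..<1})" "sets Q = sets (restrict_space borel {-1<..<1})"
    unfolding P_def Q_def by (auto intro!: sets_restrict_space_cong)
  ultimately show ?thesis
    using gai by (intro exI[of _ "(P, Q)"]) (simp add: has_distributional_derivative_def)
qed

section \<open>Orthogonality and convergence of the Legendre series\<close>

text \<open>The boundary terms vanish because the iterated integrals of the Legendre polynomial do. Taking for \<open>h\<close>
the derivatives of a polynomial gives orthogonality, taking those of \<open>f\<close> gives the coefficient bound.\<close>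

lemma iterated_integration_by_parts:
  assumes "k \<le> n"
    and ac: "\<And>i. i < k \<Longrightarrow> abs_continuous_on {-1..1} (h i)"
    and deriv: "\<And>i. i < k \<Longrightarrow> \<exists>E. negligible E \<and>
      (\<forall>x\<in>{-1..1} - E. (h i has_vector_derivative h (Suc i) x) (at x within {-1..1}))"
  shows "integral {-1..1} (\<lambda>x. h 0 x * poly (legendre_poly n) x)
      = (-1) ^ k * integral {-1..1} (\<lambda>x. h k x * poly (rodrigues n (n - k)) x)"
  using assms
proof (induction k)
  case 0
  then show ?case by (simp add: rodrigues_eq_legendre)
next
  case (Suc k)
  have j: "n - k = Suc (n - Suc k)" "n - Suc k < n" using Suc.prems(1) by auto
  obtain E where E: "negligible E"
    "\<And>x. x \<in> {-1..1} - E \<Longrightarrow> (h k has_vector_derivative h (Suc k) x) (at x within {-1..1})"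
    using Suc.prems(3)[of k] by blast
  have "integral {-1..1} (\<lambda>x. h k x * poly (rodrigues n (n - k)) x)
      = integral {-1..1} (\<lambda>x. h k x * poly (pderiv (rodrigues n (n - Suc k))) x)"
    by (simp only: pderiv_rodrigues j(1))
  also have "\<dots> = - integral {-1..1} (\<lambda>x. h (Suc k) x * poly (rodrigues n (n - Suc k)) x)"
    using integral_by_parts_abs_continuous_poly[OF _ Suc.prems(2)[OF lessI] E, of "rodrigues n (n - Suc k)"]
    by (simp add: rodrigues_endpoints[OF j(2)])
  finally show ?case using Suc by simp
qed

lemma abs_continuous_on_poly: "abs_continuous_on {a..b} (poly p)"
proof -
  obtain L where L: "\<And>x y. x \<in> {a..b} \<Longrightarrow> y \<in> {a..b} \<Longrightarrow> \<bar>poly p x - poly p y\<bar> \<le> L * \<bar>x - y\<bar>"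
    using poly_lipschitz_on_interval[of a b p] by blast
  have "abs_continuous_on {a..b} (\<lambda>x. 1)"
    unfolding abs_continuous_on_def by (auto intro: exI[of _ 1])
  from abs_continuous_on_mult_lipschitz[OF this L] show ?thesis by simp
qed

lemma has_vector_derivative_poly: "(poly p has_vector_derivative poly (pderiv p) x) (at x within S)"
  using DERIV_subset[OF poly_DERIV]
  by (auto simp flip: has_real_derivative_iff_has_vector_derivative)

lemma higher_pderiv_eq_0: "degree p < k \<Longrightarrow> (pderiv ^^ k) p = (0 :: real poly)"
proof (induction k arbitrary: p)
  case (Suc k)
  show ?case
  proof (cases "degree p = 0")
    case True
    then have "pderiv p = 0" by (simp add: pderiv_eq_0_iff)
    moreover have "(pderiv ^^ k) 0 = (0 :: real poly)" by (induction k) auto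
    ultimately show ?thesis by (simp add: funpow_swap1)
  next
    case False
    then have "degree (pderiv p) < k" using Suc.prems by (simp add: degree_pderiv)
    then show ?thesis using Suc.IH by (simp add: funpow_swap1)
  qed
qed simp

lemma legendre_orthogonal_lower_degree:
  assumes "degree p < n"
  shows "integral {-1..1} (\<lambda>x. poly p x * poly (legendre_poly n) x) = 0"
proof -
  have "integral {-1..1} (\<lambda>x. poly ((pderiv ^^ 0) p) x * poly (legendre_poly n) x)
    = (-1) ^ n * integral {-1..1} (\<lambda>x. poly ((pderiv ^^ n) p) x * poly (rodrigues n (n - n)) x)"
    by (rule iterated_integration_by_parts[where h = "\<lambda>i. poly ((pderiv ^^ i) p)"])
      (auto intro!: abs_continuous_on_poly exI[of _ "{}"] has_vector_derivative_poly)
  then show ?thesis by (simp add: higher_pderiv_eq_0[OF assms])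
qed

lemma legendre_orthogonal:
  assumes "m \<noteq> n"
  shows "integral {-1..1} (\<lambda>x. poly (legendre_poly m) x * poly (legendre_poly n) x) = 0"
proof -
  have "m < n \<or> n < m" using assms by auto
  then show ?thesis
    using legendre_orthogonal_lower_degree[of "legendre_poly m" n]
      legendre_orthogonal_lower_degree[of "legendre_poly n" m]
    by (auto simp: legendre_poly_degree_lead_coeff mult.commute)
qed

text \<open>Integration by parts of \<open>x L\<^sub>n L'\<^sub>n\<close>, combined with \<open>x L'\<^sub>n = n L\<^sub>n + L'\<^sub>n\<^sub>-\<^sub>1\<close> and orthogonality to the
lower degree term, is a linear equation for the integral.\<close>

lemma legendre_norm:
  "integral {-1..1} (\<lambda>x. poly (legendre_poly n) x * poly (legendre_poly n) x) = 2 / (2 * real n + 1)"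
proof (cases n)
  case (Suc m)
  let ?L = "legendre_poly n"
  let ?I = "integral {-1..1} (\<lambda>x. poly ?L x * poly ?L x)"
  have int: "(\<lambda>x. poly p x) integrable_on {-1..1}" for p :: "real poly"
    by (intro integrable_continuous_real continuous_intros)
  have "rodrigues (Suc n) (Suc (Suc n)) = [:0, 1:] * pderiv ?L + smult (real (Suc n)) ?L"
    using rodrigues_Suc_Suc[of n "Suc n"]
    by (simp add: rodrigues_eq_legendre pderiv_rodrigues[symmetric])
  moreover have "rodrigues (Suc n) (Suc (Suc n)) = smult (2 * real m + 3) ?L + pderiv (legendre_poly m)"
    using rodrigues_three_term[of m "Suc m"] Suc
    by (simp add: rodrigues_eq_legendre pderiv_rodrigues[symmetric])
  ultimately have xd: "[:0, 1:] * pderiv ?L = smult (real n) ?L + pderiv (legendre_poly m)"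
    using Suc by (intro poly_ext) (auto simp: algebra_simps dest!: arg_cong[where f = poly] fun_cong)
  have deg: "degree (pderiv (legendre_poly m)) < n"
    using Suc by (simp add: degree_pderiv legendre_poly_degree_lead_coeff)
  have "integral {-1..1} (\<lambda>x. poly ([:0, 1:] * pderiv ?L) x * poly ?L x)
      = integral {-1..1} (\<lambda>x. real n * (poly ?L x * poly ?L x) + poly (pderiv (legendre_poly m)) x * poly ?L x)"
    unfolding xd by (simp add: algebra_simps)
  also have "\<dots> = real n * ?I + 0"
    using int[of "?L * ?L"] int[of "pderiv (legendre_poly m) * ?L"] legendre_orthogonal_lower_degree[OF deg]
    by (subst Henstock_Kurzweil_Integration.integral_add) (auto intro!: integrable_on_mult_right)
  finally have 1: "integral {-1..1} (\<lambda>x. poly ([:0, 1:] * pderiv ?L) x * poly ?L x) = real n * ?I" by simp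
  have "integral {-1..1} (\<lambda>x. poly ([:0, 1:] * ?L) x * poly (pderiv ?L) x)
      = 2 - integral {-1..1} (\<lambda>x. poly (pderiv ([:0, 1:] * ?L)) x * poly ?L x)"
    using integral_by_parts_abs_continuous_poly[of "-1" 1 "poly ([:0, 1:] * ?L)" "{}" "poly (pderiv ([:0, 1:] * ?L))" ?L]
      abs_continuous_on_poly has_vector_derivative_poly
    by (simp add: poly_legendre_poly_1 poly_legendre_poly_minus_1 flip: power_mult_distrib)
  also have "integral {-1..1} (\<lambda>x. poly (pderiv ([:0, 1:] * ?L)) x * poly ?L x)
      = integral {-1..1} (\<lambda>x. poly ?L x * poly ?L x + poly ([:0, 1:] * pderiv ?L) x * poly ?L x)"
    by (simp add: pderiv_mult pderiv_pCons algebra_simps)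
  also have "\<dots> = ?I + real n * ?I"
    using int[of "?L * ?L"] int[of "[:0, 1:] * pderiv ?L * ?L"] 1
    by (subst Henstock_Kurzweil_Integration.integral_add) (auto simp: mult.assoc)
  also have "integral {-1..1} (\<lambda>x. poly ([:0, 1:] * ?L) x * poly (pderiv ?L) x)
      = integral {-1..1} (\<lambda>x. poly ([:0, 1:] * pderiv ?L) x * poly ?L x)"
    by (simp add: mult_ac)
  finally have "(2 * real n + 1) * ?I = 2" unfolding 1 by (simp add: algebra_simps)
  then show ?thesis by (simp add: field_simps)
qed simp

text \<open>There is a Legendre polynomial of every degree, so subtracting a multiple of one of them lowers the
degree of \<open>p\<close>.\<close>

lemma orthogonal_to_legendre_imp_orthogonal_to_poly:
  fixes d :: "real \<Rightarrow> real"
  assumes d: "continuous_on {-1..1} d"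
    and orth: "\<And>n. integral {-1..1} (\<lambda>x. d x * poly (legendre_poly n) x) = 0"
  shows "integral {-1..1} (\<lambda>x. d x * poly p x) = 0"
proof (induction "degree p" arbitrary: p rule: less_induct)
  case less
  define n where "n = degree p"
  define c where "c = lead_coeff p / coeff (legendre_poly n) n"
  define q where "q = p - smult c (legendre_poly n)"
  have L: "degree (legendre_poly n) = n" "coeff (legendre_poly n) n \<noteq> 0"
    by (metis legendre_poly_degree_lead_coeff)+
  have int: "(\<lambda>x. d x * poly p x) integrable_on {-1..1}" for p :: "real poly"
    by (intro integrable_continuous_real continuous_intros d)
  have q0: "integral {-1..1} (\<lambda>x. d x * poly q x) = 0"
  proof (cases "q = 0")
    case False
    have "degree q \<le> n" unfolding q_def n_def
      by (intro degree_diff_le) (use L in \<open>auto simp: n_def intro: order_trans[OF degree_smult_le]\<close>)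
    moreover have "coeff q n = 0" using L by (simp add: q_def c_def n_def)
    ultimately have "degree q < n"
      using False by (metis leading_coeff_0_iff order_le_less)
    then show ?thesis using less[of q] by (simp add: n_def)
  qed simp
  have "integral {-1..1} (\<lambda>x. d x * poly p x)
    = integral {-1..1} (\<lambda>x. d x * poly q x + c * (d x * poly (legendre_poly n) x))"
    by (simp add: q_def algebra_simps)
  also have "\<dots> = integral {-1..1} (\<lambda>x. d x * poly q x) + integral {-1..1} (\<lambda>x. c * (d x * poly (legendre_poly n) x))"
    by (intro Henstock_Kurzweil_Integration.integral_add int integrable_on_mult_right)
  also have "\<dots> = 0" using q0 orth by simp
  finally show ?case .
qed

text \<open>If \<open>g\<close> is a polynomial within \<open>e\<close> of \<open>d\<close>, then \<open>\<integral> d\<^sup>2 = \<integral> d (d - g) \<le> e \<integral> \<bar>d\<bar>\<close>; let \<open>e\<close> tend to 0.\<close>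

lemma orthogonal_to_legendre_imp_zero:
  fixes d :: "real \<Rightarrow> real"
  assumes d: "continuous_on {-1..1} d"
    and orth: "\<And>n. integral {-1..1} (\<lambda>x. d x * poly (legendre_poly n) x) = 0"
    and x: "x \<in> {-1..1}"
  shows "d x = 0"
proof -
  define C where "C = integral {-1..1} (\<lambda>x. \<bar>d x\<bar>)"
  have "integral {-1..1} (\<lambda>x. d x * d x) \<le> e * C" if e: "e > 0" for e
  proof -
    obtain g where g: "real_polynomial_function g" "\<And>x. x \<in> {-1..1} \<Longrightarrow> \<bar>d x - g x\<bar> < e"
      using Stone_Weierstrass_real_polynomial_function[OF compact_Icc d e] by blast
    obtain a n where "g = (\<lambda>x. \<Sum>i\<le>n. a i * x ^ i)"
      using g(1) unfolding real_polynomial_function_iff_sum by blast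
    then have gp: "g = poly (\<Sum>i\<le>n. monom (a i) i)"
      by (auto simp: fun_eq_iff poly_sum poly_monom)
    have gc: "continuous_on {-1..1} g" unfolding gp by (intro continuous_intros)
    have "integral {-1..1} (\<lambda>x. d x * (d x - g x)) =
        integral {-1..1} (\<lambda>x. d x * d x) - integral {-1..1} (\<lambda>x. d x * g x)"
      unfolding right_diff_distrib
      by (intro Henstock_Kurzweil_Integration.integral_diff integrable_continuous_real continuous_intros d gc)
    also have "integral {-1..1} (\<lambda>x. d x * g x) = 0"
      unfolding gp by (rule orthogonal_to_legendre_imp_orthogonal_to_poly[OF d orth])
    finally have "integral {-1..1} (\<lambda>x. d x * d x) = integral {-1..1} (\<lambda>x. d x * (d x - g x))" by simp
    also have "\<dots> \<le> integral {-1..1} (\<lambda>x. e * \<bar>d x\<bar>)"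
    proof (rule integral_le)
      fix x :: real assume "x \<in> {-1..1}"
      then have "\<bar>d x * (d x - g x)\<bar> \<le> \<bar>d x\<bar> * e"
        unfolding abs_mult using g(2)[of x] by (intro mult_left_mono) auto
      then show "d x * (d x - g x) \<le> e * \<bar>d x\<bar>" by (simp add: mult.commute)
    qed (intro integrable_continuous_real continuous_intros d gc)+
    also have "\<dots> = e * C" by (simp add: C_def)
    finally show ?thesis .
  qed
  note * = this
  have C: "C \<ge> 0" unfolding C_def
    by (intro integral_nonneg integrable_continuous_real continuous_intros d) auto
  have "integral {-1..1} (\<lambda>x. d x * d x) \<le> 0"
  proof (rule field_le_epsilon)
    fix e :: real assume "e > 0"
    then have "e / (C + 1) > 0" using C by simp
    from *[OF this] have "integral {-1..1} (\<lambda>x. d x * d x) \<le> e / (C + 1) * C" .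
    also have "\<dots> \<le> e" using C \<open>e > 0\<close> by (simp add: field_simps)
    finally show "integral {-1..1} (\<lambda>x. d x * d x) \<le> 0 + e" by simp
  qed
  moreover have "integral {-1..1} (\<lambda>x. d x * d x) \<ge> 0"
    by (intro integral_nonneg integrable_continuous_real continuous_intros d) auto
  ultimately have "integral {-1..1} (\<lambda>x. d x * d x) = 0" by simp
  then have "\<forall>x\<in>{-1..1}. d x * d x = 0"
    by (subst (asm) integral_eq_0_iff) (auto intro!: continuous_intros d)
  with x show ?thesis by auto
qed

text \<open>The series converges uniformly since \<open>\<bar>L\<^sub>n\<bar> \<le> 1\<close>, so it can be integrated term by term against each
\<open>L\<^sub>m\<close>. Its sum therefore has the same coefficients as \<open>f\<close> and agrees with \<open>f\<close>.\<close>

lemma legendre_series_sums: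
  assumes f: "continuous_on {-1..1} f"
    and summ: "summable (\<lambda>n. \<bar>legendre_coeff f n\<bar>)" and x: "x \<in> {-1..1}"
  shows "(\<lambda>n. legendre_coeff f n * poly (legendre_poly n) x) sums f x"
proof -
  let ?a = "legendre_coeff f" and ?L = "\<lambda>n x. poly (legendre_poly n) x"
  define F where "F x = (\<Sum>n. ?a n * ?L n x)" for x
  have bd: "norm (?a n * ?L n x) \<le> \<bar>?a n\<bar>" if "x \<in> {-1..1}" for n x
    using abs_legendre_le_1[of x n] that by (auto simp: abs_mult intro: mult_left_le)
  have sm: "summable (\<lambda>n. ?a n * ?L n x)" if "x \<in> {-1..1}" for x
    by (rule summable_comparison_test'[OF summ, of 0]) (use bd that in auto)
  have u: "uniform_limit {-1..1} (\<lambda>n x. \<Sum>i<n. ?a i * ?L i x) F sequentially"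
    unfolding F_def by (rule Weierstrass_m_test[OF bd summ])
  have F: "continuous_on {-1..1} F"
    by (rule uniform_limit_theorem[OF _ u]) (auto intro!: always_eventually continuous_intros)
  have orth: "integral {-1..1} (\<lambda>x. (f x - F x) * ?L m x) = 0" for m
  proof -
    have "uniform_limit {-1..1} (\<lambda>n x. \<Sum>i<n. ?a i * ?L i x * ?L m x)
        (\<lambda>x. \<Sum>i. ?a i * ?L i x * ?L m x) sequentially"
    proof (rule Weierstrass_m_test[OF _ summ])
      fix n and x :: real assume x: "x \<in> {-1..1}"
      have "norm (?a n * ?L n x * ?L m x) \<le> norm (?a n * ?L n x) * 1"
        unfolding norm_mult[of "?a n * ?L n x"] using abs_legendre_le_1[of x m] x by (intro mult_left_mono) auto
      then show "norm (?a n * ?L n x * ?L m x) \<le> \<bar>?a n\<bar>" using bd[OF x, of n] by simp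
    qed
    then obtain I J where I: "\<And>n. ((\<lambda>x. \<Sum>i<n. ?a i * ?L i x * ?L m x) has_integral I n) {-1..1}"
      and J: "((\<lambda>x. \<Sum>i. ?a i * ?L i x * ?L m x) has_integral J) {-1..1}" and IJ: "I \<longlonglongrightarrow> J"
      by (rule uniform_limit_integral[where a = "-1" and b = 1])
        (auto intro!: continuous_intros)
    have "I n = ?a m * (2 / (2 * real m + 1))" if "n > m" for n
    proof -
      have t: "((\<lambda>x. ?a i * ?L i x * ?L m x) has_integral (if i = m then ?a m * (2 / (2 * real m + 1)) else 0)) {-1..1}" for i
      proof -
        have "(\<lambda>x. ?L i x * ?L m x) integrable_on {-1..1}"
          by (intro integrable_continuous_real continuous_intros)
        then have "((\<lambda>x. ?L i x * ?L m x) has_integral (if i = m then 2 / (2 * real m + 1) else 0)) {-1..1}"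
          using legendre_orthogonal[of i m] legendre_norm[of m] by (auto simp: has_integral_iff)
        from has_integral_mult_right[OF this, of "?a i"] show ?thesis
          by (auto simp: mult.assoc split: if_splits)
      qed
      have "((\<lambda>x. \<Sum>i<n. ?a i * ?L i x * ?L m x) has_integral
          (\<Sum>i<n. if i = m then ?a m * (2 / (2 * real m + 1)) else 0)) {-1..1}"
        by (intro has_integral_sum t) auto
      from has_integral_unique[OF I this] show ?thesis using that by simp
    qed
    then have "eventually (\<lambda>n. I n = ?a m * (2 / (2 * real m + 1))) sequentially"
      by (rule eventually_mono[OF eventually_gt_at_top[of m]])
    then have "I \<longlonglongrightarrow> ?a m * (2 / (2 * real m + 1))" by (rule tendsto_eventually)
    with IJ have Jv: "J = ?a m * (2 / (2 * real m + 1))" by (rule LIMSEQ_unique)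
    have "((\<lambda>x. F x * ?L m x) has_integral J) {-1..1}"
    proof (rule has_integral_eq[OF _ J])
      fix x :: real assume "x \<in> {-1..1}"
      from suminf_mult2[OF sm[OF this], of "?L m x"]
      show "(\<Sum>i. ?a i * ?L i x * ?L m x) = F x * ?L m x" by (simp add: F_def)
    qed
    moreover have "((\<lambda>x. f x * ?L m x) has_integral J) {-1..1}"
    proof -
      have "(\<lambda>x. f x * ?L m x) integrable_on {-1..1}"
        by (intro integrable_continuous_real continuous_intros f)
      moreover have "J = integral {-1..1} (\<lambda>x. f x * ?L m x)"
        unfolding Jv legendre_coeff_def by (simp add: field_simps)
      ultimately show ?thesis by (simp add: has_integral_iff)
    qed
    ultimately have "((\<lambda>x. f x * ?L m x - F x * ?L m x) has_integral (J - J)) {-1..1}"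
      by (intro has_integral_diff)
    then show ?thesis by (simp add: left_diff_distrib integral_unique)
  qed
  have "f x - F x = 0"
    by (rule orthogonal_to_legendre_imp_zero[OF _ orth x]) (intro continuous_intros f F)
  then show ?thesis using summable_sums[OF sm[OF x]] by (simp add: F_def)
qed

section \<open>The error of the partial sums\<close>

lemma legendre_partial_sum_error:
  assumes f: "continuous_on {-1..1} f"
    and q: "\<And>i. \<bar>legendre_coeff f (Suc N + i)\<bar> \<le> q i" and B: "\<And>K. (\<Sum>i<K. q i) \<le> B"
  shows "sup_norm (\<lambda>x. f x - legendre_partial_sum f N x) \<le> B"
  unfolding sup_norm_def
proof (rule cSUP_least)
  let ?a = "legendre_coeff f"
  have q0: "0 \<le> q i" for i using q[of i] by linarith
  have sq: "summable q" by (rule summableI_nonneg_bounded[OF q0 B])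
  have "summable (\<lambda>i. \<bar>?a (i + Suc N)\<bar>)"
    by (rule summable_comparison_test'[OF sq, of 0]) (use q in \<open>simp add: add.commute\<close>)
  then have summ: "summable (\<lambda>n. \<bar>?a n\<bar>)"
    by (subst (asm) summable_iff_shift)
  fix x :: real assume x: "x \<in> {-1..1}"
  let ?t = "\<lambda>n. ?a n * poly (legendre_poly n) x"
  note sums = legendre_series_sums[OF f summ x]
  have "legendre_partial_sum f N x = (\<Sum>n<Suc N. ?t n)"
    by (simp only: legendre_partial_sum_def lessThan_Suc_atMost)
  then have "f x - legendre_partial_sum f N x = (\<Sum>i. ?t (i + Suc N))"
    using suminf_split_initial_segment[OF sums_summable[OF sums], of "Suc N"] sums_unique[OF sums]
    by simp
  also have "\<bar>\<dots>\<bar> \<le> (\<Sum>i. q i)"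
  proof -
    have le: "norm (?t (i + Suc N)) \<le> q i" for i
    proof -
      have "\<bar>?a (i + Suc N)\<bar> * \<bar>poly (legendre_poly (i + Suc N)) x\<bar> \<le> \<bar>?a (i + Suc N)\<bar> * 1"
        using abs_legendre_le_1[of x] x by (intro mult_left_mono) auto
      then show ?thesis using q[of i] by (simp add: abs_mult add.commute)
    qed
    have s: "summable (\<lambda>i. \<bar>?t (i + Suc N)\<bar>)"
      by (rule summable_comparison_test'[OF sq, of 0]) (use le in simp)
    have "(\<Sum>i. \<bar>?t (i + Suc N)\<bar>) \<le> (\<Sum>i. q i)"
      by (rule suminf_le[OF _ s sq]) (use le in simp)
    with summable_rabs[OF s] show ?thesis by linarith
  qed
  also have "\<dots> \<le> B" by (rule suminf_le_const[OF sq B])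
  finally show "\<bar>f x - legendre_partial_sum f N x\<bar> \<le> B" .
qed simp

lemma nth_deriv_Suc:
  "nth_deriv (Suc k) f = (\<lambda>x. vector_derivative (nth_deriv k f) (at x within {-1..1}))"
  by (simp add: nth_deriv_def)

lemma AE_lebesgue_on_imp_negligible:
  assumes "AE x in lebesgue_on S. P x" "S \<in> sets lebesgue"
  obtains E where "negligible E" "\<And>x. x \<in> S - E \<Longrightarrow> P x"
proof -
  have "AE x in lebesgue. x \<in> S \<longrightarrow> P x"
    using assms by (simp add: AE_restrict_space_iff)
  then obtain E where "E \<in> null_sets lebesgue" "{x. \<not> (x \<in> S \<longrightarrow> P x)} \<subseteq> E"
    unfolding eventually_ae_filter by auto
  then show ?thesis by (intro that[of E]) (auto simp: negligible_iff_null_sets)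
qed

text \<open>\<open>r\<close> integrations by parts with almost everywhere derivatives, followed by one against the
distributional derivative of the last one, and the maximum of the \<open>(r + 1)\<close>-fold integral of \<open>L\<^sub>n\<close>.\<close>

lemma legendre_coeff_bound:
  fixes f :: "real \<Rightarrow> real" and r n :: nat
  assumes r: "r \<ge> 1"
    and diff: "\<And>k. Suc k < r \<Longrightarrow> nth_deriv k f differentiable_on {-1..1}"
    and ac: "\<And>k. k < r \<Longrightarrow> abs_continuous_on {-1..1} (nth_deriv k f)"
    and bv: "\<exists>g. bounded_variation_on {-1..1} g \<and>
           (AE x in lebesgue_on {-1..1}.
              (nth_deriv (r - 1) f has_vector_derivative g x) (at x within {-1..1}))"
    and n: "r < n"
  defines "U \<equiv> deriv_total_variation (nth_deriv r f)"
  shows "0 \<le> U"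
    "\<bar>legendre_coeff f n\<bar> \<le> (real n + 1/2) * (const_A * U /
      (sqrt (real (n - Suc r) + 1/2) * step_two_prod (real (n - Suc r)) (Suc r)))"
proof -
  obtain g where g: "bounded_variation_on {-1..1} g" and
    AEg: "AE x in lebesgue_on {-1..1}. (nth_deriv (r - 1) f has_vector_derivative g x) (at x within {-1..1})"
    using bv by blast
  obtain E where E: "negligible E" and
    dE: "\<And>x. x \<in> {-1..1} - E \<Longrightarrow> (nth_deriv (r - 1) f has_vector_derivative g x) (at x within {-1..1})"
    by (rule AE_lebesgue_on_imp_negligible[OF AEg]) (simp, blast)
  \<comment> \<open>derivatives within a nondegenerate interval are unique, so the chosen one is \<open>g x\<close>\<close>
  have rg: "nth_deriv r f x = g x" if "x \<in> {-1..1} - E" for x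
    using nth_deriv_Suc[of "r - 1" f] r vector_derivative_within_closed_interval[OF _ _ dE[OF that]] that
    by simp
  have deriv: "\<exists>E. negligible E \<and> (\<forall>x\<in>{-1..1} - E.
      (nth_deriv i f has_vector_derivative nth_deriv (Suc i) f x) (at x within {-1..1}))" if i: "i < r" for i
  proof (cases "Suc i < r")
    case True
    from diff[OF this] show ?thesis
      by (intro exI[of _ "{}"]) (auto simp: nth_deriv_Suc differentiable_on_def vector_derivative_works)
  next
    case False
    with i have "Suc i = r" by simp
    then show ?thesis using E dE rg by (intro exI[of _ E]) auto
  qed
  obtain P Q where PQ: "(SOME \<nu>. has_distributional_derivative (nth_deriv r f) \<nu>) = (P, Q)"
    by force
  have "has_distributional_derivative (nth_deriv r f) (P, Q)"
    unfolding PQ[symmetric] by (rule someI_ex, rule distributional_derivative_exists[OF g E rg])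
  note dd = this
  have U: "U = signed_total_variation (P, Q)"
    by (simp add: U_def deriv_total_variation_def PQ)
  have fin: "finite_measure P" "finite_measure Q"
    and sP: "sets P = sets (restrict_space borel {-1<..<1})" and sQ: "sets Q = sets P"
    using dd unfolding has_distributional_derivative_def by auto
  have sp: "space P = {-1<..<1}"
    using sets_eq_imp_space_eq[OF sP] by (simp add: space_restrict_space)
  show "0 \<le> U"
    using abs_integral_diff_le_total_variation[OF fin sQ, of "\<lambda>_. 0" 1] U by simp
  define j where "j = n - Suc r"
  define M where "M = const_A / (sqrt (real j + 1/2) * step_two_prod (real j) (Suc r))"
  have j: "j < n" "n - j = Suc r" "n - r = Suc j" using n by (auto simp: j_def)
  have "integral {-1..1} (\<lambda>x. nth_deriv 0 f x * poly (legendre_poly n) x)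
      = (-1) ^ r * integral {-1..1} (\<lambda>x. nth_deriv r f x * poly (rodrigues n (n - r)) x)"
    by (rule iterated_integration_by_parts[where h = "\<lambda>i. nth_deriv i f"]) (use n ac deriv in auto)
  also have "integral {-1..1} (\<lambda>x. nth_deriv r f x * poly (rodrigues n (n - r)) x)
      = integral {-1<..<1} (\<lambda>x. nth_deriv r f x * poly (pderiv (rodrigues n j)) x)"
    by (simp only: pderiv_rodrigues j(3) integral_open_interval_real)
  also have "\<dots> = - (integral\<^sup>L P (poly (rodrigues n j)) - integral\<^sup>L Q (poly (rodrigues n j)))"
    by (rule distributional_derivative_poly[OF dd rodrigues_endpoints[OF j(1)]])
  finally have "\<bar>integral {-1..1} (\<lambda>x. f x * poly (legendre_poly n) x)\<bar>
      = \<bar>integral\<^sup>L P (poly (rodrigues n j)) - integral\<^sup>L Q (poly (rodrigues n j))\<bar>"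
    by (simp add: nth_deriv_def abs_mult)
  also have "\<dots> \<le> M * U"
    unfolding U
  proof (rule abs_integral_diff_le_total_variation[OF fin sQ])
    have "poly (rodrigues n j) \<in> borel_measurable borel"
      by (intro borel_measurable_continuous_onI continuous_intros)
    then have "poly (rodrigues n j) \<in> borel_measurable (restrict_space borel {-1<..<1})"
      by (rule measurable_restrict_space1)
    then show "poly (rodrigues n j) \<in> borel_measurable P"
      using measurable_cong_sets[OF sP refl] by blast
    show "\<bar>poly (rodrigues n j) x\<bar> \<le> M" if "x \<in> space P" for x
      using rodrigues_bound[of x j n] that j by (auto simp: sp M_def)
    show "0 \<le> M"
      unfolding M_def using step_two_prod_pos[of "real j" "Suc r"] by (simp add: const_A_def)
  qed
  finally have "\<bar>integral {-1..1} (\<lambda>x. f x * poly (legendre_poly n) x)\<bar> \<le> M * U" .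
  then have "(real n + 1/2) * \<bar>integral {-1..1} (\<lambda>x. f x * poly (legendre_poly n) x)\<bar> \<le> (real n + 1/2) * (M * U)"
    by (rule mult_left_mono) simp
  moreover have "\<bar>legendre_coeff f n\<bar> = (real n + 1/2) * \<bar>integral {-1..1} (\<lambda>x. f x * poly (legendre_poly n) x)\<bar>"
    unfolding legendre_coeff_def abs_mult by simp
  ultimately show "\<bar>legendre_coeff f n\<bar> \<le> (real n + 1/2) * (const_A * U /
      (sqrt (real (n - Suc r) + 1/2) * step_two_prod (real (n - Suc r)) (Suc r)))"
    by (simp add: M_def j_def)
qed

theorem theorem2:
  fixes f :: "real \<Rightarrow> real" and r N :: nat and U :: real
  assumes "r \<ge> 1"
    and "\<And>k. Suc k < r \<Longrightarrow> nth_deriv k f differentiable_on {-1..1}"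
    and "\<And>k. k < r \<Longrightarrow> abs_continuous_on {-1..1} (nth_deriv k f)"
    and "\<exists>g. bounded_variation_on {-1..1} g \<and>
           (AE x in lebesgue_on {-1..1}.
              (nth_deriv (r - 1) f has_vector_derivative g x) (at x within {-1..1}))"
    and "U = deriv_total_variation (nth_deriv r f)"
    and "N \<ge> r + 1"
  shows "sup_norm (\<lambda>x. f x - legendre_partial_sum f N x) \<le>
    (if r = 1 then 2 * const_A * U / sqrt (real N - 2/3)
     else if odd r then
       const_A * (real N + 3/2) * U /
         ((real r - 1/2) * sqrt (real N - real r + 1/3)
           * (\<Prod>j=1..r. real N - real r + 2 * real j - 3/2))
     else
       const_A * (real N + 1/2) * U /
         ((real r - 1/2) * sqrt (real N - real r + 1/3)
           * (\<Prod>j=1..r. real N - real r + 2 * real j - 3/2)))"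
proof -
  define m where "m = real N - real r"
  define M where "M = N - r"
  have m: "real M = m" "m \<ge> 1" "real N = m + real r"
    using \<open>N \<ge> r + 1\<close> by (auto simp: m_def M_def)
  have coeff: "0 \<le> U" "\<bar>legendre_coeff f n\<bar> \<le> (real n + 1/2) * (const_A * U /
      (sqrt (real (n - Suc r) + 1/2) * step_two_prod (real (n - Suc r)) (Suc r)))" if "r < n" for n
    unfolding assms(5)
    by (rule legendre_coeff_bound[OF assms(1) _ _ assms(4) that]; use assms(2,3) in blast)+
  have U0: "0 \<le> U" by (rule coeff(1)[OF lessI])
  have A0: "0 \<le> const_A" by (simp add: const_A_def)
  define q where "q i = (real (M + i) + real r + 3/2) /
      (sqrt (real (M + i) + 1/2) * step_two_prod (real (M + i)) (Suc r))" for i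
  define T where "T = (tail_bound r m + tail_bound r (m + 1)) / (2 * real r - 1)"
  have cont: "continuous_on {-1..1} f"
    using abs_continuous_on_continuous[OF assms(3)[of 0]] assms(1) by (simp add: nth_deriv_def)
  have "sup_norm (\<lambda>x. f x - legendre_partial_sum f N x) \<le> const_A * U * T"
  proof (rule legendre_partial_sum_error[OF cont])
    fix i
    have i: "Suc N + i - Suc r = M + i" "r < Suc N + i" "real (Suc N + i) + 1/2 = real (M + i) + real r + 3/2"
      using \<open>N \<ge> r + 1\<close> by (auto simp: M_def)
    show "\<bar>legendre_coeff f (Suc N + i)\<bar> \<le> const_A * U * q i"
      using coeff(2)[OF i(2)] unfolding i(1,3) q_def by (simp add: mult_ac)
  next
    fix K
    have "(\<Sum>i<K. const_A * U * q i) = const_A * U * (\<Sum>i<K. q i)" by (simp add: sum_distrib_left)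
    also have "\<dots> \<le> const_A * U * T"
      using sum_tail_le[OF assms(1), where M = M and K = K] U0 A0
      unfolding T_def q_def m(1) by (intro mult_left_mono) auto
    finally show "(\<Sum>i<K. const_A * U * q i) \<le> const_A * U * T" .
  qed
  also have "const_A * U * T \<le> (if r = 1 then 2 * const_A * U / sqrt (real N - 2/3)
     else if odd r then
       const_A * (real N + 3/2) * U /
         ((real r - 1/2) * sqrt (real N - real r + 1/3)
           * (\<Prod>j=1..r. real N - real r + 2 * real j - 3/2))
     else
       const_A * (real N + 1/2) * U /
         ((real r - 1/2) * sqrt (real N - real r + 1/3)
           * (\<Prod>j=1..r. real N - real r + 2 * real j - 3/2)))"
  proof (cases "r = 1")
    case True
    have "T \<le> 2 / sqrt (m + 1/3)"
      using tail_bound_le_1[of m] m(2) True by (simp add: T_def)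
    then have "const_A * U * T \<le> const_A * U * (2 / sqrt (m + 1/3))"
      using U0 A0 by (intro mult_left_mono) auto
    moreover have "real N - 2/3 = m + 1/3" using m(3) True by simp
    ultimately show ?thesis using True by (simp add: mult_ac)
  next
    case False
    define R where "R = sqrt (m + 1/3) * (\<Prod>j=1..r. m + 2 * real j - 3/2)"
    have R: "R > 0" unfolding R_def using m(2) by (intro mult_pos_pos prod_pos) auto
    have r: "real r - 1/2 > 0" using assms(1) by simp
    have "0 \<le> m" using m(2) by simp
    have "tail_bound r m + tail_bound r (m + 1) \<le> 2 * ((m + real r + 1/2) / R)"
      using tail_bound_le[OF \<open>0 \<le> m\<close> assms(1), folded R_def] by linarith
    then have "T \<le> (2 * ((m + real r + 1/2) / R)) / (2 * real r - 1)"
      unfolding T_def using r by (intro divide_right_mono) auto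
    also have "\<dots> = (real N + 1/2) / ((real r - 1/2) * R)"
      using r R by (simp add: m(3) field_simps)
    finally have T: "T \<le> (real N + 1/2) / ((real r - 1/2) * R)" .
    also have "\<dots> \<le> (real N + 3/2) / ((real r - 1/2) * R)"
      using r R by (intro divide_right_mono) auto
    finally have T': "T \<le> (real N + 3/2) / ((real r - 1/2) * R)" .
    have AU: "0 \<le> const_A * U" using A0 U0 by simp
    have "const_A * U * T \<le> const_A * U * ((real N + 1/2) / ((real r - 1/2) * R))"
      "const_A * U * T \<le> const_A * U * ((real N + 3/2) / ((real r - 1/2) * R))"
      by (rule mult_left_mono[OF T AU], rule mult_left_mono[OF T' AU])
    with False show ?thesis
      unfolding R_def m_def by (simp add: mult_ac)
  qed
  finally show ?thesis .
qed

end
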